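(* Let $(a_n)_{n\ge 0}$ (positive) and $(b_n)_{n\ge 0}$ (real) be Jacobi parameters with Jacobi matrix $\mathcal{A}$ and Jacobi operator $A$. Let $(\rho_n)_{n\ge0}$ be a positive sequence tending to infinity. Let $\breve A$ be a self-adjoint extension of $A$ acting on $\ell^2(\mathbb{N}_0)$. If for some interval $(a,b)$ we have $\sigma_{\mathrm{ess}}(\breve A)\cap(a,b)=\emptyset$, then $\frac1{\rho_n}\nu_n|_{(a,b)}$ converges vaguely to $0$ on $(a,b)$, i.e. $\lim_{n\to\infty}\frac1{\rho_n}\int f\,d\nu_n=0$ for every continuous $f$ compactly supported in $(a,b)$.
   Context: $\mathcal{A}$ is the infinite symmetric tridiagonal matrix with diagonal $b_0,b_1,\dots$ and off-diagonal $a_0,a_1,\dots$; $\mathcal{A}_n$ is its upper-left $n\times n$ truncation; $\nu_n=\sum_{y\in\sigma(\mathcal{A}_{n+1})}\delta_y$ with $\delta_y$ the Dirac measure at $y$. The Jacobi operator $A$ is the closure in $\ell^2(\mathbb{N}_0)$ of the operator acting on finitely supported sequences by multiplication by $\mathcal{A}$. $\sigma_{\mathrm{ess}}$ denotes the essential spectrum. *)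

theory Defs
  imports
    "HOL-Probability.Probability"
    "HOL-Library.Function_Algebras"
    "Jordan_Normal_Form.Spectral_Radius"
begin

section \<open>The sequence space\<close>

text \<open>Sequences are functions \<open>nat \<Rightarrow> complex\<close>; addition and subtraction are pointwise.\<close>

definition scale_seq :: "complex \<Rightarrow> (nat \<Rightarrow> complex) \<Rightarrow> (nat \<Rightarrow> complex)" where
  "scale_seq c x = (\<lambda>n. c * x n)"

interpretation cseq: vector_space scale_seq
  by unfold_locales (auto simp: scale_seq_def algebra_simps fun_eq_iff)

definition ell2 :: "(nat \<Rightarrow> complex) set" where
  "ell2 = {x. summable (\<lambda>n. (cmod (x n))\<^sup>2)}"

definition l2_inner :: "(nat \<Rightarrow> complex) \<Rightarrow> (nat \<Rightarrow> complex) \<Rightarrow> complex" where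
  "l2_inner x y = (\<Sum>n. x n * cnj (y n))"

definition l2_norm :: "(nat \<Rightarrow> complex) \<Rightarrow> real" where
  "l2_norm x = sqrt (\<Sum>n. (cmod (x n))\<^sup>2)"

section \<open>Unbounded operators on the sequence space\<close>

text \<open>An unbounded operator is identified with its graph, so its domain is the relational
  \<^const>\<open>Domain\<close> and extension of operators is inclusion of graphs.\<close>

type_synonym l2_graph = "((nat \<Rightarrow> complex) \<times> (nat \<Rightarrow> complex)) set"

definition l2_operator :: "l2_graph \<Rightarrow> bool" where
  "l2_operator T \<longleftrightarrow>
     T \<subseteq> ell2 \<times> ell2 \<and> single_valued T \<and> (0, 0) \<in> T \<and>
     (\<forall>x y u v. (x, y) \<in> T \<longrightarrow> (u, v) \<in> T \<longrightarrow> (x + u, y + v) \<in> T) \<and>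
     (\<forall>c x y. (x, y) \<in> T \<longrightarrow> (scale_seq c x, scale_seq c y) \<in> T)"

definition densely_defined :: "l2_graph \<Rightarrow> bool" where
  "densely_defined T \<longleftrightarrow> (\<forall>x\<in>ell2. \<forall>e>0. \<exists>u\<in>Domain T. l2_norm (u - x) < e)"

definition op_closure :: "l2_graph \<Rightarrow> l2_graph" where
  "op_closure T = {(x, y). x \<in> ell2 \<and> y \<in> ell2 \<and>
     (\<forall>e>0. \<exists>(u, v)\<in>T. l2_norm (u - x) < e \<and> l2_norm (v - y) < e)}"

definition adjoint_op :: "l2_graph \<Rightarrow> l2_graph" where
  "adjoint_op T = {(y, z). y \<in> ell2 \<and> z \<in> ell2 \<and> (\<forall>(x, w)\<in>T. l2_inner w y = l2_inner x z)}"

definition self_adjoint_op :: "l2_graph \<Rightarrow> bool" where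
  "self_adjoint_op T \<longleftrightarrow> l2_operator T \<and> densely_defined T \<and> adjoint_op T = T"

text \<open>\<open>z\<close> lies in the resolvent set iff \<open>T - z\<close> maps the domain of \<open>T\<close> bijectively onto
  \<^const>\<open>ell2\<close>, with bounded inverse.\<close>

definition op_resolvent_set :: "l2_graph \<Rightarrow> complex set" where
  "op_resolvent_set T = {z.
     (\<forall>y\<in>ell2. \<exists>!x. \<exists>w. (x, w) \<in> T \<and> w - scale_seq z x = y) \<and>
     (\<exists>C. \<forall>(x, w)\<in>T. l2_norm x \<le> C * l2_norm (w - scale_seq z x))}"

definition op_spectrum :: "l2_graph \<Rightarrow> complex set" where
  "op_spectrum T = - op_resolvent_set T"

definition op_eigenspace :: "l2_graph \<Rightarrow> complex \<Rightarrow> (nat \<Rightarrow> complex) set" where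
  "op_eigenspace T z = {x. (x, scale_seq z x) \<in> T}"

definition discrete_spectrum :: "l2_graph \<Rightarrow> complex set" where
  "discrete_spectrum T = {z. z isolated_in op_spectrum T \<and> op_eigenspace T z \<noteq> {0} \<and>
     (\<exists>B. finite B \<and> op_eigenspace T z \<subseteq> cseq.span B)}"

text \<open>For self-adjoint \<open>T\<close>, the essential spectrum is what remains of the spectrum after removing the
  isolated eigenvalues of finite multiplicity.\<close>

definition essential_spectrum :: "l2_graph \<Rightarrow> complex set" where
  "essential_spectrum T = op_spectrum T - discrete_spectrum T"

section \<open>Jacobi matrices and operators\<close>

definition jacobi_matrix :: "(nat \<Rightarrow> real) \<Rightarrow> (nat \<Rightarrow> real) \<Rightarrow> nat \<Rightarrow> nat \<Rightarrow> real" where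
  "jacobi_matrix a b i j =
     (if i = j then b i else if j = Suc i then a i else if i = Suc j then a j else 0)"

definition jacobi_truncation :: "(nat \<Rightarrow> real) \<Rightarrow> (nat \<Rightarrow> real) \<Rightarrow> nat \<Rightarrow> real mat" where
  "jacobi_truncation a b n = mat n n (\<lambda>(i, j). jacobi_matrix a b i j)"

definition finitely_supported :: "(nat \<Rightarrow> complex) set" where
  "finitely_supported = {x. finite {n. x n \<noteq> 0}}"

definition jacobi_mult :: "(nat \<Rightarrow> real) \<Rightarrow> (nat \<Rightarrow> real) \<Rightarrow> (nat \<Rightarrow> complex) \<Rightarrow> (nat \<Rightarrow> complex)" where
  "jacobi_mult a b x = (\<lambda>i. \<Sum>j | x j \<noteq> 0. complex_of_real (jacobi_matrix a b i j) * x j)"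

definition jacobi_operator :: "(nat \<Rightarrow> real) \<Rightarrow> (nat \<Rightarrow> real) \<Rightarrow> l2_graph" where
  "jacobi_operator a b = op_closure {(x, jacobi_mult a b x) | x. x \<in> finitely_supported}"

section \<open>Eigenvalue counting measures\<close>

definition dirac_sum :: "real set \<Rightarrow> real measure" where
  "dirac_sum S = measure_of UNIV (sets borel) (\<lambda>X. \<Sum>y\<in>S. emeasure (return borel y) X)"

text \<open>The truncations are real symmetric, so all their eigenvalues are real and it suffices to take
  the spectrum over the reals.\<close>

definition nu :: "(nat \<Rightarrow> real) \<Rightarrow> (nat \<Rightarrow> real) \<Rightarrow> nat \<Rightarrow> real measure" where
  "nu a b n = dirac_sum (spectrum (jacobi_truncation a b (Suc n)))"

text \<open>\<^const>\<open>measure_of\<close> returns the null measure when the given set function is not a measure;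
  this does not happen here.\<close>

lemma sets_dirac_sum [simp, measurable_cong]: "sets (dirac_sum S) = sets borel"
  unfolding dirac_sum_def using sets.sigma_sets_eq[of "borel :: real measure"] by simp

lemma space_dirac_sum [simp]: "space (dirac_sum S) = UNIV"
  by (simp add: dirac_sum_def space_measure_of_conv)

lemma emeasure_dirac_sum:
  assumes "X \<in> sets borel"
  shows "emeasure (dirac_sum S) X = (\<Sum>y\<in>S. emeasure (return borel y) X)"
proof (rule emeasure_measure_of[OF dirac_sum_def])
  show "sets borel \<subseteq> Pow (UNIV :: real set)" by simp
  show "positive (sets (dirac_sum S)) (\<lambda>X. \<Sum>y\<in>S. emeasure (return borel y) X)"
    by (simp add: positive_def)
  show "countably_additive (sets (dirac_sum S)) (\<lambda>X. \<Sum>y\<in>S. emeasure (return borel y) X)"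
  proof (rule countably_additiveI)
    fix F :: "nat \<Rightarrow> real set"
    assume F: "range F \<subseteq> sets (dirac_sum S)" "disjoint_family F"
    have "(\<Sum>i. \<Sum>y\<in>S. emeasure (return borel y) (F i)) =
          (\<Sum>y\<in>S. \<Sum>i. emeasure (return borel y) (F i))"
      by (rule suminf_sum) simp
    also have "\<dots> = (\<Sum>y\<in>S. emeasure (return borel y) (\<Union>i. F i))"
      by (rule sum.cong[OF refl], rule suminf_emeasure) (use F in auto)
    finally show "(\<Sum>i. \<Sum>y\<in>S. emeasure (return borel y) (F i)) =
        (\<Sum>y\<in>S. emeasure (return borel y) (\<Union>i. F i))" .
  qed
  show "X \<in> sets (dirac_sum S)" using assms by simp
qed

end

theory Submission
  imports Defs "HOL-Complex_Analysis.Complex_Analysis"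
begin

text \<open>
  The integral of \<open>f\<close> against \<open>\<nu>\<^sub>n\<close> is a sum of \<open>f\<close> over those eigenvalues of the truncation that lie
  in the support of \<open>f\<close>. As \<open>f\<close> is bounded and \<open>\<rho>\<^sub>n \<rightarrow> \<infinity>\<close>, it is enough that the number of these
  eigenvalues stays bounded in \<open>n\<close>, and by compactness of the support this is a local question: every
  real \<open>\<lambda>\<close> outside the essential spectrum should have a neighbourhood that contains at most
  \<open>M\<close> eigenvalues of each truncation, with \<open>M\<close> independent of \<open>n\<close>.

  Off the essential spectrum \<open>T - \<lambda>\<close> is bounded below on the orthogonal complement of finitely many
  vectors \<open>B\<close> (\<open>bounded_below_off_essential_spectrum\<close>). Given more than \<open>card B + 1\<close> eigenvectors of a
  truncation with eigenvalues close to \<open>\<lambda>\<close>, some nonzero combination \<open>x\<close> of them is orthogonal to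
  \<open>B\<close> and has last entry \<open>0\<close>. The vanishing last entry makes \<open>T\<close> act on \<open>x\<close> exactly as the truncation
  does, so \<open>(T - \<lambda>) x\<close> is small compared with \<open>x\<close>, a contradiction
  (\<open>few_truncation_eigenvalues_nearby\<close>).

  If \<open>\<lambda>\<close> is in the resolvent set, the lower bound is the boundedness of the inverse. If \<open>\<lambda>\<close> is an
  isolated eigenvalue of finite multiplicity, \<open>B\<close> spans the eigenspace, and one has to show that
  \<open>\<lambda>\<close> stops being a spectral point on its orthogonal complement. This is done here without the spectral
  theorem (\<open>isolated_point_gap\<close>). For \<open>y\<close> orthogonal to the eigenspace, let
  \<open>f(\<zeta>) = \<langle>(T - \<lambda> - \<zeta>)\<^sup>-\<^sup>1 y, y\<rangle>\<close>, which is holomorphic near \<open>0\<close> except at \<open>0\<close>. Self-adjointness gives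
  \<open>\<bar>Im \<zeta>\<bar> \<cdot> \<bar>f(\<zeta>)\<bar> \<le> \<parallel>y\<parallel>\<^sup>2\<close>; the maximum principle turns this into a bound \<open>const / \<bar>\<zeta>\<bar>\<close>,
  so the singularity is at most a simple pole. Its residue vanishes, because weak limits of
  \<open>\<i>s (T - \<lambda> - \<i>s)\<^sup>-\<^sup>1 y\<close> as \<open>s \<rightarrow> 0\<close> are eigenvectors orthogonal to the eigenspace. Hence \<open>f\<close> extends
  holomorphically to \<open>0\<close> with an explicit bound (\<open>removable_singularity_bound\<close>), which would fail if
  \<open>(T - \<lambda>) y\<close> were much smaller than \<open>y\<close>.
\<close>

section \<open>Square-summable sequences\<close>

lemma L2_set_le_l2_norm:
  assumes "x \<in> ell2" "finite I"
  shows "L2_set (\<lambda>n. cmod (x n)) I \<le> l2_norm x"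
  using assms unfolding L2_set_def l2_norm_def ell2_def
  by (intro real_sqrt_le_mono sum_le_suminf) auto


lemma l2_norm_nonneg: "x \<in> ell2 \<Longrightarrow> 0 \<le> l2_norm x"
  unfolding l2_norm_def ell2_def by (intro real_sqrt_ge_zero suminf_nonneg) auto

text \<open>Uniform bounds on finite sections give membership and the norm bound at once; the triangle inequality
  and the weak lower semicontinuity of the norm both come from here.\<close>
lemma ell2_boundI:
  assumes "\<And>N. L2_set (\<lambda>n. cmod (x n)) {..<N} \<le> M"
  shows "x \<in> ell2" and "l2_norm x \<le> M"
proof -
  have M: "0 \<le> M" using assms[of 0] by simp
  have le: "(\<Sum>n<N. (cmod (x n))\<^sup>2) \<le> M\<^sup>2" for N
    using power_mono[OF assms[of N], of 2] by (simp add: L2_set_def sum_nonneg)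
  have sm: "summable (\<lambda>n. (cmod (x n))\<^sup>2)"
    by (rule summableI_nonneg_bounded[OF _ le]) simp
  then show "x \<in> ell2" by (simp add: ell2_def)
  have "(\<Sum>n. (cmod (x n))\<^sup>2) \<le> M\<^sup>2" by (rule suminf_le_const[OF sm le])
  then show "l2_norm x \<le> M" unfolding l2_norm_def using M real_le_lsqrt by blast
qed

lemma ell2_add:
  assumes "x \<in> ell2" "y \<in> ell2"
  shows "x + y \<in> ell2" and "l2_norm (x + y) \<le> l2_norm x + l2_norm y"
proof -
  have "L2_set (\<lambda>n. cmod ((x + y) n)) {..<N} \<le> l2_norm x + l2_norm y" for N
  proof -
    have "L2_set (\<lambda>n. cmod ((x + y) n)) {..<N} \<le> L2_set (\<lambda>n. cmod (x n) + cmod (y n)) {..<N}"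
      by (rule L2_set_mono) (auto simp: norm_triangle_ineq)
    also have "\<dots> \<le> L2_set (\<lambda>n. cmod (x n)) {..<N} + L2_set (\<lambda>n. cmod (y n)) {..<N}"
      by (rule L2_set_triangle_ineq)
    finally show ?thesis
      using L2_set_le_l2_norm[OF assms(1), of "{..<N}"] L2_set_le_l2_norm[OF assms(2), of "{..<N}"]
      by simp
  qed
  from ell2_boundI[OF this]
  show "x + y \<in> ell2" "l2_norm (x + y) \<le> l2_norm x + l2_norm y" by (auto simp: plus_fun_def)
qed

lemma ell2_scale: "x \<in> ell2 \<Longrightarrow> scale_seq c x \<in> ell2"
  unfolding ell2_def scale_seq_def by (simp add: norm_mult power_mult_distrib summable_mult)

lemma l2_norm_scale: "x \<in> ell2 \<Longrightarrow> l2_norm (scale_seq c x) = cmod c * l2_norm x"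
  unfolding ell2_def scale_seq_def l2_norm_def
  by (simp add: norm_mult power_mult_distrib suminf_mult real_sqrt_mult)

lemma diff_eq_add_scale: "x - y = x + scale_seq (-1) y"
  by (simp add: scale_seq_def fun_eq_iff)

lemma ell2_diff:
  assumes "x \<in> ell2" "y \<in> ell2"
  shows "x - y \<in> ell2" and "l2_norm (x - y) \<le> l2_norm x + l2_norm y"
  using ell2_add[OF assms(1) ell2_scale[OF assms(2), of "-1"]] l2_norm_scale[OF assms(2), of "-1"]
  unfolding diff_eq_add_scale[of x y] by simp_all

lemma ell2_zero: "0 \<in> ell2" by (simp add: ell2_def)

lemma l2_norm_zero: "l2_norm 0 = 0" by (simp add: l2_norm_def)

lemma l2_norm_eq_0:
  assumes "x \<in> ell2" "l2_norm x = 0"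
  shows "x = 0"
proof
  fix n
  have "cmod (x n) \<le> 0" using L2_set_le_l2_norm[OF assms(1), of "{n}"] assms(2) by simp
  then show "x n = 0 n" by simp
qed

lemma ell2_finite_support:
  assumes "\<And>n. n \<ge> N \<Longrightarrow> x n = 0"
  shows "x \<in> ell2"
  unfolding ell2_def using summable_finite[of "{..<N}" "\<lambda>n. (cmod (x n))\<^sup>2"] assms
  by (auto simp: not_less)

lemma l2_prod_bound:
  assumes "x \<in> ell2" "y \<in> ell2"
  shows "summable (\<lambda>n. cmod (x n) * cmod (y n))"
    and "(\<Sum>n. cmod (x n) * cmod (y n)) \<le> l2_norm x * l2_norm y"
proof -
  have le: "(\<Sum>n<N. cmod (x n) * cmod (y n)) \<le> l2_norm x * l2_norm y" for N
  proof -
    have "(\<Sum>n<N. cmod (x n) * cmod (y n))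
        \<le> L2_set (\<lambda>n. cmod (x n)) {..<N} * L2_set (\<lambda>n. cmod (y n)) {..<N}"
      using L2_set_mult_ineq[of "\<lambda>n. cmod (x n)" "\<lambda>n. cmod (y n)" "{..<N}"] by simp
    also have "\<dots> \<le> l2_norm x * l2_norm y"
      using assms by (intro mult_mono L2_set_le_l2_norm l2_norm_nonneg) auto
    finally show ?thesis .
  qed
  show sm: "summable (\<lambda>n. cmod (x n) * cmod (y n))"
    by (rule summableI_nonneg_bounded[OF _ le]) simp
  show "(\<Sum>n. cmod (x n) * cmod (y n)) \<le> l2_norm x * l2_norm y"
    by (rule suminf_le_const[OF sm le])
qed

lemma summable_l2_inner:
  assumes "x \<in> ell2" "y \<in> ell2"
  shows "summable (\<lambda>n. x n * cnj (y n))"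
  by (rule summable_norm_cancel) (use l2_prod_bound(1)[OF assms] in \<open>simp add: norm_mult\<close>)

lemma l2_Cauchy_Schwarz:
  assumes "x \<in> ell2" "y \<in> ell2"
  shows "cmod (l2_inner x y) \<le> l2_norm x * l2_norm y"
proof -
  have "cmod (l2_inner x y) \<le> (\<Sum>n. cmod (x n * cnj (y n)))"
    unfolding l2_inner_def
    by (rule summable_norm) (use l2_prod_bound(1)[OF assms] in \<open>simp add: norm_mult\<close>)
  then show ?thesis using l2_prod_bound(2)[OF assms] by (simp add: norm_mult)
qed

lemma l2_inner_add_left:
  assumes "x \<in> ell2" "y \<in> ell2" "w \<in> ell2"
  shows "l2_inner (x + y) w = l2_inner x w + l2_inner y w"
  unfolding l2_inner_def using summable_l2_inner assms
  by (simp add: algebra_simps suminf_add)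

lemma l2_inner_scale_left:
  assumes "x \<in> ell2" "w \<in> ell2"
  shows "l2_inner (scale_seq c x) w = c * l2_inner x w"
  unfolding l2_inner_def scale_seq_def using suminf_mult[OF summable_l2_inner[OF assms], of c]
  by (simp add: algebra_simps)

lemma l2_inner_diff_left:
  assumes "x \<in> ell2" "y \<in> ell2" "w \<in> ell2"
  shows "l2_inner (x - y) w = l2_inner x w - l2_inner y w"
  unfolding diff_eq_add_scale[of x y] l2_inner_add_left[OF assms(1) ell2_scale[OF assms(2)] assms(3)]
    l2_inner_scale_left[OF assms(2,3)] by simp

lemma cnj_l2_inner:
  assumes "x \<in> ell2" "y \<in> ell2"
  shows "cnj (l2_inner x y) = l2_inner y x"
  unfolding l2_inner_def using sums_cnj[of "\<lambda>n. x n * cnj (y n)"] summable_l2_inner[OF assms]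
  by (metis (no_types, lifting) complex_cnj_cnj complex_cnj_mult mult.commute suminf_cong summable_sums sums_unique)

lemma l2_inner_scale_right:
  assumes "x \<in> ell2" "w \<in> ell2"
  shows "l2_inner x (scale_seq c w) = cnj c * l2_inner x w"
  using arg_cong[OF l2_inner_scale_left[OF assms(2,1), of c], of cnj] assms
  by (simp add: cnj_l2_inner ell2_scale)

lemma l2_inner_self:
  assumes "x \<in> ell2"
  shows "l2_inner x x = complex_of_real ((l2_norm x)\<^sup>2)"
proof -
  have "(l2_norm x)\<^sup>2 = (\<Sum>n. (cmod (x n))\<^sup>2)"
    using assms unfolding l2_norm_def ell2_def by (simp add: suminf_nonneg)
  moreover have "(\<Sum>n. complex_of_real ((cmod (x n))\<^sup>2)) = complex_of_real (\<Sum>n. (cmod (x n))\<^sup>2)"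
    using assms unfolding ell2_def by (simp add: suminf_of_real)
  ultimately show ?thesis unfolding l2_inner_def by (simp only: complex_norm_square)
qed

lemma l2_tail_tendsto_0:
  assumes "x \<in> ell2"
  shows "(\<lambda>N. l2_norm (\<lambda>n. if n < N then 0 else x n)) \<longlonglongrightarrow> 0"
proof -
  let ?g = "\<lambda>n. (cmod (x n))\<^sup>2"
  have sm: "summable ?g" using assms by (simp add: ell2_def)
  have "(\<Sum>n. (cmod (if n < N then 0 else x n))\<^sup>2) = suminf ?g - sum ?g {..<N}" for N
  proof -
    have "(\<lambda>n. if n \<in> {..<N} then ?g n else 0) sums sum ?g {..<N}"
      by (rule sums_If_finite_set) simp
    from sums_diff[OF summable_sums[OF sm] this]
    have "(\<lambda>n. (cmod (if n < N then 0 else x n))\<^sup>2) sums (suminf ?g - sum ?g {..<N})"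
      by (rule sums_cong[THEN iffD1, rotated]) auto
    then show ?thesis by (simp add: sums_iff)
  qed
  moreover have "(\<lambda>N. sqrt (suminf ?g - sum ?g {..<N})) \<longlonglongrightarrow> sqrt (suminf ?g - suminf ?g)"
    by (intro tendsto_intros summable_LIMSEQ[OF sm])
  ultimately show ?thesis by (simp add: l2_norm_def)
qed

lemma l2_inner_split:
  assumes "x \<in> ell2" "w \<in> ell2"
  shows "l2_inner x w = (\<Sum>n<N. x n * cnj (w n)) + l2_inner x (\<lambda>n. if n < N then 0 else w n)"
proof -
  let ?g = "\<lambda>n. x n * cnj (w n)"
  have sm: "summable ?g" by (rule summable_l2_inner[OF assms])
  have "(\<lambda>n. if n \<in> {..<N} then ?g n else 0) sums sum ?g {..<N}"
    by (rule sums_If_finite_set) simp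
  from sums_diff[OF summable_sums[OF sm] this]
  have "(\<lambda>n. x n * cnj (if n < N then 0 else w n)) sums (suminf ?g - sum ?g {..<N})"
    by (rule sums_cong[THEN iffD1, rotated]) auto
  then show ?thesis by (simp add: sums_iff l2_inner_def)
qed

text \<open>Testing against the first \<open>N\<close> coordinates of \<open>w\<close> converges because only finitely many coordinates
  are involved; the remainder is uniformly small by Cauchy-Schwarz, since the tails of \<open>w\<close> tend to \<open>0\<close>.\<close>
lemma l2_weak_limit:
  assumes x: "\<And>k. x k \<in> ell2" "\<And>k. l2_norm (x k) \<le> M"
    and lim: "\<And>i. (\<lambda>k. x k i) \<longlonglongrightarrow> z i"
  shows "z \<in> ell2" and "w \<in> ell2 \<Longrightarrow> (\<lambda>k. l2_inner (x k) w) \<longlonglongrightarrow> l2_inner z w"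
proof -
  have bound: "L2_set (\<lambda>n. cmod (z n)) {..<N} \<le> M" for N
  proof (rule LIMSEQ_le_const2)
    show "(\<lambda>k. L2_set (\<lambda>n. cmod (x k n)) {..<N}) \<longlonglongrightarrow> L2_set (\<lambda>n. cmod (z n)) {..<N}"
      unfolding L2_set_def by (intro tendsto_intros lim)
    show "\<exists>K. \<forall>k\<ge>K. L2_set (\<lambda>n. cmod (x k n)) {..<N} \<le> M"
      using L2_set_le_l2_norm[OF x(1), of "{..<N}"] x(2) by (meson finite_lessThan order_trans)
  qed
  note zM = ell2_boundI[OF bound]
  show z: "z \<in> ell2" by (rule zM(1))
  have M: "0 \<le> M" using bound[of 0] by simp
  assume w: "w \<in> ell2"
  let ?t = "\<lambda>N n. if n < N then 0 else w n"
  have t: "?t N \<in> ell2" for N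
    using w summable_comparison_test[of "\<lambda>n. (cmod (?t N n))\<^sup>2" "\<lambda>n. (cmod (w n))\<^sup>2"]
    unfolding ell2_def by auto
  show "(\<lambda>k. l2_inner (x k) w) \<longlonglongrightarrow> l2_inner z w"
  proof (rule LIMSEQ_I)
    fix e :: real assume e: "0 < e"
    have "(\<lambda>N. M * l2_norm (?t N)) \<longlonglongrightarrow> M * 0"
      by (intro tendsto_intros l2_tail_tendsto_0[OF w])
    then have "\<forall>\<^sub>F N in sequentially. M * l2_norm (?t N) < e / 3"
      using e by (intro order_tendstoD(2)) auto
    then obtain N where N: "M * l2_norm (?t N) < e / 3"
      by (meson eventually_at_top_linorder order_refl)
    have small: "cmod (l2_inner v (?t N)) < e / 3" if "v \<in> ell2" "l2_norm v \<le> M" for v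
      using l2_Cauchy_Schwarz[OF that(1) t[of N]]
        mult_right_mono[OF that(2) l2_norm_nonneg[OF t[of N]]] N by linarith
    let ?s = "\<lambda>v. \<Sum>n<N. v n * cnj (w n)"
    have "(\<lambda>k. ?s (x k)) \<longlonglongrightarrow> ?s z" by (intro tendsto_intros lim)
    from LIMSEQ_D[OF this, of "e / 3"] e
    obtain K where K: "\<And>k. k \<ge> K \<Longrightarrow> cmod (?s (x k) - ?s z) < e / 3" by auto
    show "\<exists>K. \<forall>k\<ge>K. cmod (l2_inner (x k) w - l2_inner z w) < e"
    proof (intro exI[of _ K] allI impI)
      fix k assume k: "k \<ge> K"
      have "l2_inner (x k) w - l2_inner z w
          = (?s (x k) - ?s z) + (l2_inner (x k) (?t N) - l2_inner z (?t N))"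
        using l2_inner_split[OF x(1) w, of k N] l2_inner_split[OF z w, of N] by simp
      then have "cmod (l2_inner (x k) w - l2_inner z w) \<le> cmod (?s (x k) - ?s z)
          + (cmod (l2_inner (x k) (?t N)) + cmod (l2_inner z (?t N)))"
        by (simp only:) (rule order_trans[OF norm_triangle_ineq add_left_mono[OF norm_triangle_ineq4]])
      then show "cmod (l2_inner (x k) w - l2_inner z w) < e"
        using K[OF k] small[OF x(1) x(2), of k] small[OF z zM(2)] by linarith
    qed
  qed
qed

lemma l2_weakly_compact:
  assumes x: "\<And>k. x k \<in> ell2" "\<And>k. l2_norm (x k) \<le> M"
  obtains z :: "nat \<Rightarrow> complex" and r :: "nat \<Rightarrow> nat" where "strict_mono r" "z \<in> ell2"
    "\<And>w. w \<in> ell2 \<Longrightarrow> (\<lambda>k. l2_inner (x (r k)) w) \<longlonglongrightarrow> l2_inner z w"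
proof -
  have "cmod (x k i) \<le> M" for k i
    using L2_set_le_l2_norm[OF x(1), of "{i}" k] x(2)[of k] by simp
  then obtain r where r: "strict_mono r"
    "\<And>i. i \<in> (UNIV :: nat set) \<Longrightarrow> \<exists>l. (\<lambda>k. x (r k) i) \<longlonglongrightarrow> l"
    using function_convergent_subsequence[of "UNIV :: nat set" x M] by (metis countableI_type)
  then obtain z where z: "\<And>i. (\<lambda>k. x (r k) i) \<longlonglongrightarrow> z i" by (metis UNIV_I)
  from l2_weak_limit[of "\<lambda>k. x (r k)" M z, OF x z] r(1) that show ?thesis by blast
qed

section \<open>Resolvent-like singularities on the real axis\<close>

text \<open>The bound \<open>K / \<bar>Im z\<bar>\<close> is useless where the circle meets the real axis. On the circle of centre
  \<open>c\<close> and radius \<open>\<rho>\<close>, however, \<open>\<bar>(z - c)\<^sup>2 - \<rho>\<^sup>2\<bar> = 2 \<rho> \<bar>Im z\<bar>\<close>, so multiplying \<open>f\<close> by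
  \<open>(z - c)\<^sup>2 - \<rho>\<^sup>2\<close> gives a function bounded by \<open>2 \<rho> K\<close> there. By the maximum principle this
  persists inside the circle, and on the line \<open>Re w = c\<close> the factor has modulus at least \<open>\<rho>\<^sup>2\<close>.\<close>
lemma circle_bound_above_real_centre:
  fixes f :: "complex \<Rightarrow> complex" and c \<rho> K :: real
  assumes f: "f holomorphic_on cball (of_real c) \<rho>"
    and K: "\<And>z. z \<in> sphere (of_real c) \<rho> \<Longrightarrow> \<bar>Im z\<bar> * cmod (f z) \<le> K"
    and w: "w \<in> cball (of_real c) \<rho>" "Re w = c" and \<rho>: "0 < \<rho>"
  shows "\<rho> * cmod (f w) \<le> 2 * K"
proof -
  let ?h = "\<lambda>z. ((z - of_real c)\<^sup>2 - of_real (\<rho>\<^sup>2)) * f z"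
  have h: "?h holomorphic_on cball (of_real c) \<rho>"
    by (intro holomorphic_intros f)
  have "cmod (?h w) \<le> 2 * \<rho> * K"
  proof (rule maximum_modulus_frontier[of ?h "cball (of_real c) \<rho>"])
    show "?h holomorphic_on interior (cball (of_real c) \<rho>)"
      using h holomorphic_on_subset interior_subset by blast
    show "continuous_on (closure (cball (of_real c) \<rho>)) ?h"
      using holomorphic_on_imp_continuous_on[OF h] by simp
    fix z assume "z \<in> frontier (cball (complex_of_real c) \<rho>)"
    then have z: "z \<in> sphere (of_real c) \<rho>" using \<rho> by simp
    let ?u = "z - of_real c"
    have n: "cmod ?u = \<rho>" using z by (simp add: dist_norm norm_minus_commute)
    have "of_real (\<rho>\<^sup>2) = ?u * cnj ?u"
      using complex_norm_square[of ?u] n by simp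
    then have "?u\<^sup>2 - of_real (\<rho>\<^sup>2) = ?u * (?u - cnj ?u)"
      by (simp add: power2_eq_square algebra_simps)
    moreover have "?u - cnj ?u = of_real (2 * Im z) * \<i>"
      by (simp add: complex_eq_iff)
    ultimately have "cmod (?u\<^sup>2 - of_real (\<rho>\<^sup>2)) = \<rho> * (2 * \<bar>Im z\<bar>)"
      using n by (simp add: norm_mult)
    then have "cmod (?h z) = 2 * \<rho> * (\<bar>Im z\<bar> * cmod (f z))"
      by (simp add: norm_mult)
    also have "\<dots> \<le> 2 * \<rho> * K" using K[OF z] \<rho> by (intro mult_left_mono) auto
    finally show "cmod (?h z) \<le> 2 * \<rho> * K" .
  qed (use w in auto)
  moreover have "(w - of_real c)\<^sup>2 - of_real (\<rho>\<^sup>2) = - of_real ((Im w)\<^sup>2 + \<rho>\<^sup>2)"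
    using w(2) by (simp add: complex_eq_iff power2_eq_square)
  then have "cmod ((w - of_real c)\<^sup>2 - of_real (\<rho>\<^sup>2)) = (Im w)\<^sup>2 + \<rho>\<^sup>2"
    by (metis norm_minus_cancel norm_of_real abs_of_nonneg sum_power2_ge_zero)
  ultimately have "((Im w)\<^sup>2 + \<rho>\<^sup>2) * cmod (f w) \<le> 2 * \<rho> * K"
    by (simp add: norm_mult)
  moreover have "\<rho>\<^sup>2 * cmod (f w) \<le> ((Im w)\<^sup>2 + \<rho>\<^sup>2) * cmod (f w)"
    by (intro mult_right_mono) auto
  ultimately have "\<rho> * (\<rho> * cmod (f w)) \<le> \<rho> * (2 * K)"
    by (simp add: power2_eq_square mult.assoc mult.left_commute)
  then show ?thesis using \<rho> by simp
qed

text \<open>Away from the real axis the hypothesis suffices. Near it, the preceding lemma applies to a circle that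
  is centred at \<open>Re w\<close> and has a radius comparable with \<open>\<bar>w\<bar>\<close>, which avoids the singularity.\<close>
lemma pole_order_at_most_one:
  fixes f :: "complex \<Rightarrow> complex"
  assumes f: "f holomorphic_on ball 0 r - {0}"
    and K: "\<And>z. z \<in> ball 0 r - {0} \<Longrightarrow> \<bar>Im z\<bar> * cmod (f z) \<le> K"
    and w: "w \<noteq> 0" "cmod w < r / 2"
  shows "cmod (w * f w) \<le> 6 * K"
proof -
  have "cmod w < r" using w(2) norm_ge_zero[of w] by linarith
  then have wb: "w \<in> ball 0 r - {0}" using w(1) by simp
  have K0: "0 \<le> K" using K[OF wb] by (meson abs_ge_zero mult_nonneg_nonneg norm_ge_zero order_trans)
  have le: "cmod w \<le> \<bar>Re w\<bar> + \<bar>Im w\<bar>" by (rule cmod_le)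
  show ?thesis
  proof (cases "\<bar>Re w\<bar> \<le> 2 * \<bar>Im w\<bar>")
    case True
    then have "cmod w * cmod (f w) \<le> (3 * \<bar>Im w\<bar>) * cmod (f w)"
      using le by (intro mult_right_mono) auto
    with K[OF wb] K0 show ?thesis by (simp add: norm_mult)
  next
    case False
    let ?c = "complex_of_real (Re w)" and ?\<rho> = "\<bar>Re w\<bar> / 2"
    have \<rho>: "0 < ?\<rho>" using False by auto
    have sub: "cball ?c ?\<rho> \<subseteq> ball 0 r - {0}"
    proof
      fix z assume "z \<in> cball ?c ?\<rho>"
      then have z: "cmod (z - ?c) \<le> ?\<rho>" by (simp add: dist_norm norm_minus_commute)
      have "cmod z \<le> cmod (z - ?c) + \<bar>Re w\<bar>"
        using norm_triangle_ineq[of "z - ?c" ?c] by simp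
      moreover have "\<bar>Re w\<bar> \<le> cmod z + cmod (z - ?c)"
        using norm_triangle_ineq4[of z "z - ?c"] by simp
      ultimately show "z \<in> ball 0 r - {0}"
        using z abs_Re_le_cmod[of w] w(2) \<rho> by auto
    qed
    have "?\<rho> * cmod (f w) \<le> 2 * K"
    proof (rule circle_bound_above_real_centre[where c = "Re w" and f = f and w = w])
      show "f holomorphic_on cball ?c ?\<rho>" using holomorphic_on_subset[OF f sub] .
      show "\<bar>Im z\<bar> * cmod (f z) \<le> K" if "z \<in> sphere ?c ?\<rho>" for z
        using that sub K by (meson sphere_cball subsetD)
      have "w - ?c = of_real (Im w) * \<i>" by (simp add: complex_eq_iff)
      then have "cmod (w - ?c) = \<bar>Im w\<bar>" by (simp add: norm_mult)
      then show "w \<in> cball ?c ?\<rho>" using False by (simp add: dist_norm norm_minus_commute)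
    qed (use \<rho> in auto)
    moreover have "cmod w * cmod (f w) \<le> (3 * ?\<rho>) * cmod (f w)"
      using le False by (intro mult_right_mono) auto
    ultimately show ?thesis by (simp add: norm_mult)
  qed
qed

text \<open>The sequence \<open>s\<close> serves to show that the residue is \<open>0\<close>. Once the singularity is removed, the circle
  bound can be used with centre \<open>0\<close>, so that the estimate does not deteriorate as \<open>t\<close> tends to \<open>0\<close>.\<close>
lemma removable_singularity_bound:
  fixes f :: "complex \<Rightarrow> complex" and s :: "nat \<Rightarrow> complex"
  assumes f: "f holomorphic_on ball 0 r - {0}"
    and K: "\<And>z. z \<in> ball 0 r - {0} \<Longrightarrow> \<bar>Im z\<bar> * cmod (f z) \<le> K"
    and s: "\<And>k. s k \<noteq> 0" "s \<longlonglongrightarrow> 0" "(\<lambda>k. s k * f (s k)) \<longlonglongrightarrow> 0"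
    and \<rho>: "0 < \<rho>" "\<rho> < r" and t: "t \<noteq> 0" "\<bar>t\<bar> \<le> \<rho>"
  shows "\<rho> * cmod (f (of_real t * \<i>)) \<le> 2 * K"
proof -
  have r: "0 < r" using \<rho> by simp
  have "(\<lambda>z. z * f z) holomorphic_on ball 0 r - {0}" by (intro holomorphic_intros f)
  moreover have "\<exists>B. \<forall>\<^sub>F z in at 0. cmod (z * f z) \<le> B"
  proof (intro exI)
    have "\<forall>\<^sub>F z in at 0. z \<in> ball 0 (r / 2) - {0 :: complex}"
      using r by (intro eventually_at_in_open) auto
    then show "\<forall>\<^sub>F z in at 0. cmod (z * f z) \<le> 6 * K"
      by eventually_elim (use pole_order_at_most_one[OF f K] in auto)
  qed
  ultimately obtain g where g: "g holomorphic_on ball 0 r"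
    and gf: "\<And>z. z \<in> ball 0 r - {0} \<Longrightarrow> g z = z * f z"
    using holomorphic_on_extend_bounded[of "\<lambda>z. z * f z" "ball 0 r" 0] r by auto
  have "isCont g 0"
    using holomorphic_on_imp_continuous_on[OF g] r by (simp add: continuous_on_eq_continuous_at)
  then have "(\<lambda>k. g (s k)) \<longlonglongrightarrow> g 0" by (rule isCont_tendsto_compose) (rule s(2))
  moreover have "\<forall>\<^sub>F k in sequentially. s k \<in> ball 0 r"
    using s(2) r by (metis centre_in_ball open_ball topological_tendstoD)
  then have "\<forall>\<^sub>F k in sequentially. g (s k) = s k * f (s k)"
    by eventually_elim (use gf s(1) in auto)
  with s(3) have "(\<lambda>k. g (s k)) \<longlonglongrightarrow> 0" by (simp add: tendsto_cong)
  ultimately have g0: "g 0 = 0" by (rule LIMSEQ_unique)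
  have "((\<lambda>z. z * f z) \<longlongrightarrow> 0) (at 0)"
  proof (rule Lim_transform_within_open[of g 0 0 UNIV "ball 0 r"])
    show "g \<midarrow>0\<rightarrow> 0" using \<open>isCont g 0\<close> g0 by (simp add: continuous_at)
  qed (use gf r in auto)
  then obtain F where F: "F holomorphic_on ball 0 r"
    and Ff: "\<And>z. z \<in> ball 0 r - {0} \<Longrightarrow> F z = f z"
    using holomorphic_on_extend_lim[OF f] r by auto
  have "\<rho> * cmod (F (of_real t * \<i>)) \<le> 2 * K"
  proof (rule circle_bound_above_real_centre[where c = 0 and f = F and w = "of_real t * \<i>"])
    show "F holomorphic_on cball (of_real 0) \<rho>"
      by (rule holomorphic_on_subset[OF F]) (use \<rho> in auto)
    show "\<bar>Im z\<bar> * cmod (F z) \<le> K" if "z \<in> sphere (of_real 0) \<rho>" for z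
    proof -
      have "z \<in> ball 0 r - {0}" using that \<rho> by auto
      then show ?thesis using K Ff by metis
    qed
  qed (use \<rho> t in \<open>auto simp: norm_mult\<close>)
  moreover have "of_real t * \<i> \<in> ball 0 r - {0}" using \<rho> t by (auto simp: norm_mult)
  ultimately show ?thesis using Ff by metis
qed

section \<open>Self-adjoint operators\<close>

lemma l2_operatorD:
  assumes "l2_operator T" "(x, w) \<in> T"
  shows "x \<in> ell2" and "w \<in> ell2"
  using assms unfolding l2_operator_def by auto

lemma l2_operator_add_scale:
  assumes "l2_operator T" "(x, w) \<in> T" "(u, v) \<in> T"
  shows "(x + scale_seq c u, w + scale_seq c v) \<in> T"
  using assms unfolding l2_operator_def by blast

lemma self_adjoint_imp_l2_operator: "self_adjoint_op T \<Longrightarrow> l2_operator T"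
  by (simp add: self_adjoint_op_def)

lemma self_adjoint_symmetric:
  assumes "self_adjoint_op T" "(x, w) \<in> T" "(u, v) \<in> T"
  shows "l2_inner w u = l2_inner x v"
proof -
  have "(u, v) \<in> adjoint_op T" using assms by (simp add: self_adjoint_op_def)
  then show ?thesis using assms(2) unfolding adjoint_op_def by auto
qed

lemma self_adjoint_maximal:
  assumes "self_adjoint_op T" "u \<in> ell2" "v \<in> ell2"
    and "\<And>x w. (x, w) \<in> T \<Longrightarrow> l2_inner w u = l2_inner x v"
  shows "(u, v) \<in> T"
proof -
  have "(u, v) \<in> adjoint_op T" using assms unfolding adjoint_op_def by auto
  then show ?thesis using assms(1) by (simp add: self_adjoint_op_def)
qed

text \<open>The number \<open>\<langle>w, x\<rangle>\<close> is real by symmetry, so the imaginary part of \<open>\<langle>w - z x, x\<rangle>\<close> is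
  \<open>- Im z \<parallel>x\<parallel>\<^sup>2\<close>; Cauchy-Schwarz does the rest.\<close>
lemma self_adjoint_imaginary_bound:
  assumes T: "self_adjoint_op T" and xw: "(x, w) \<in> T"
  shows "\<bar>Im z\<bar> * l2_norm x \<le> l2_norm (w - scale_seq z x)"
proof -
  note mem = l2_operatorD[OF self_adjoint_imp_l2_operator[OF T] xw]
  have d: "w - scale_seq z x \<in> ell2" by (intro ell2_diff ell2_scale mem)
  have "cnj (l2_inner w x) = l2_inner w x"
    using self_adjoint_symmetric[OF T xw xw] cnj_l2_inner[OF mem(2,1)] by simp
  then have "Im (l2_inner w x) = 0" by (metis cnj.simps(2) equal_neg_zero)
  moreover have "l2_inner (w - scale_seq z x) x = l2_inner w x - z * of_real ((l2_norm x)\<^sup>2)"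
    using l2_inner_diff_left[OF mem(2) ell2_scale[OF mem(1)] mem(1)]
      l2_inner_scale_left[OF mem(1,1)] l2_inner_self[OF mem(1)] by metis
  ultimately have "\<bar>Im (l2_inner (w - scale_seq z x) x)\<bar> = \<bar>Im z\<bar> * (l2_norm x)\<^sup>2"
    by (simp add: abs_mult del: of_real_power)
  then have "\<bar>Im z\<bar> * (l2_norm x)\<^sup>2 \<le> l2_norm (w - scale_seq z x) * l2_norm x"
    using abs_Im_le_cmod[of "l2_inner (w - scale_seq z x) x"] l2_Cauchy_Schwarz[OF d mem(1)]
    by linarith
  then have "l2_norm x * (\<bar>Im z\<bar> * l2_norm x) \<le> l2_norm x * l2_norm (w - scale_seq z x)"
    by (simp add: power2_eq_square mult.commute mult.left_commute)
  then show ?thesis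
    using l2_norm_nonneg[OF mem(1)] l2_norm_nonneg[OF d]
    by (cases "l2_norm x = 0") auto
qed

section \<open>The resolvent\<close>

definition resolvent :: "l2_graph \<Rightarrow> complex \<Rightarrow> (nat \<Rightarrow> complex) \<Rightarrow> (nat \<Rightarrow> complex)" where
  "resolvent T z y = (THE x. \<exists>w. (x, w) \<in> T \<and> w - scale_seq z x = y)"

lemma resolvent_graph:
  assumes "z \<in> op_resolvent_set T" "y \<in> ell2"
  shows "(resolvent T z y, y + scale_seq z (resolvent T z y)) \<in> T"
proof -
  have "\<exists>!x. \<exists>w. (x, w) \<in> T \<and> w - scale_seq z x = y"
    using assms unfolding op_resolvent_set_def by auto
  from theI'[OF this] obtain w where w: "(resolvent T z y, w) \<in> T"
    "w - scale_seq z (resolvent T z y) = y"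
    unfolding resolvent_def by blast
  from w(2) have "w = y + scale_seq z (resolvent T z y)" by (metis diff_add_cancel)
  with w(1) show ?thesis by simp
qed

lemma resolvent_unique:
  assumes "z \<in> op_resolvent_set T" "y \<in> ell2" "(x, w) \<in> T" "w - scale_seq z x = y"
  shows "resolvent T z y = x"
proof -
  have "\<exists>!x. \<exists>w. (x, w) \<in> T \<and> w - scale_seq z x = y"
    using assms unfolding op_resolvent_set_def by auto
  then show ?thesis unfolding resolvent_def using assms(3,4) by (intro the1_equality) auto
qed

lemma resolvent_ell2:
  assumes "l2_operator T" "z \<in> op_resolvent_set T" "y \<in> ell2"
  shows "resolvent T z y \<in> ell2"
  using l2_operatorD(1)[OF assms(1) resolvent_graph[OF assms(2,3)]] .

lemma resolvent_imaginary_bound: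
  assumes "self_adjoint_op T" "z \<in> op_resolvent_set T" "y \<in> ell2"
  shows "\<bar>Im z\<bar> * l2_norm (resolvent T z y) \<le> l2_norm y"
  using self_adjoint_imaginary_bound[OF assms(1) resolvent_graph[OF assms(2,3)], of z] by simp

lemma resolvent_identity:
  assumes T: "l2_operator T" and z: "z \<in> op_resolvent_set T" and w: "w \<in> op_resolvent_set T"
    and y: "y \<in> ell2"
  shows "resolvent T z y = resolvent T w y + scale_seq (z - w) (resolvent T z (resolvent T w y))"
proof (rule resolvent_unique[OF z y])
  note wy = resolvent_ell2[OF T w y]
  show "(resolvent T w y + scale_seq (z - w) (resolvent T z (resolvent T w y)),
      (y + scale_seq w (resolvent T w y)) + scale_seq (z - w)
        (resolvent T w y + scale_seq z (resolvent T z (resolvent T w y)))) \<in> T"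
    by (intro l2_operator_add_scale[OF T] resolvent_graph z w y wy)
qed (simp add: fun_eq_iff scale_seq_def algebra_simps)

text \<open>Near \<open>w\<close>, replacing \<open>T - w\<close> by \<open>T - z\<close> is a perturbation of norm \<open>\<bar>z - w\<bar>\<close>, which can be absorbed
  into the lower bound for \<open>T - w\<close>.\<close>
lemma resolvent_locally_bounded:
  assumes T: "l2_operator T" and w: "w \<in> op_resolvent_set T"
  obtains C \<delta> where "0 < C" "0 < \<delta>"
    "\<And>z y. z \<in> op_resolvent_set T \<Longrightarrow> dist z w < \<delta> \<Longrightarrow> y \<in> ell2 \<Longrightarrow>
      l2_norm (resolvent T z y) \<le> C * l2_norm y"
proof -
  obtain C0 where C0: "\<And>x v. (x, v) \<in> T \<Longrightarrow> l2_norm x \<le> C0 * l2_norm (v - scale_seq w x)"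
    using w unfolding op_resolvent_set_def by blast
  define C where "C = \<bar>C0\<bar> + 1"
  have C: "0 < C" "C0 \<le> C" by (auto simp: C_def)
  show thesis
  proof (rule that[of "2 * C" "1 / (2 * C)"])
    fix z y assume z: "z \<in> op_resolvent_set T" "dist z w < 1 / (2 * C)" and y: "y \<in> ell2"
    let ?x = "resolvent T z y"
    note x = resolvent_ell2[OF T z(1) y]
    have d: "y + scale_seq z ?x - scale_seq w ?x = y + scale_seq (z - w) ?x"
      by (simp add: fun_eq_iff scale_seq_def algebra_simps)
    have n: "l2_norm (y + scale_seq (z - w) ?x) \<le> l2_norm y + cmod (z - w) * l2_norm ?x"
      using ell2_add(2)[OF y ell2_scale[OF x, of "z - w"]] l2_norm_scale[OF x] by simp
    have "l2_norm ?x \<le> C0 * l2_norm (y + scale_seq (z - w) ?x)"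
      using C0[OF resolvent_graph[OF z(1) y]] d by simp
    also have "\<dots> \<le> C * l2_norm (y + scale_seq (z - w) ?x)"
      by (intro mult_right_mono C l2_norm_nonneg ell2_add y ell2_scale x)
    also have "\<dots> \<le> C * (l2_norm y + cmod (z - w) * l2_norm ?x)"
      using n C by (intro mult_left_mono) auto
    also have "cmod (z - w) * l2_norm ?x \<le> 1 / (2 * C) * l2_norm ?x"
      using z(2) l2_norm_nonneg[OF x] by (intro mult_right_mono) (auto simp: dist_norm)
    finally have "l2_norm ?x \<le> C * (l2_norm y + 1 / (2 * C) * l2_norm ?x)"
      using C by simp
    then show "l2_norm ?x \<le> 2 * C * l2_norm y"
      using C by (simp add: field_simps)
  qed (use C in auto)
qed

lemma resolvent_weakly_continuous:
  assumes T: "l2_operator T" and U: "open U" "U \<subseteq> op_resolvent_set T" "w \<in> U"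
    and y: "y \<in> ell2" and v: "v \<in> ell2"
  shows "((\<lambda>z. l2_inner (resolvent T z y) v) \<longlongrightarrow> l2_inner (resolvent T w y) v) (at w)"
proof -
  have w: "w \<in> op_resolvent_set T" using U by auto
  obtain C \<delta> where C: "0 < C" "0 < \<delta>"
    "\<And>z y. z \<in> op_resolvent_set T \<Longrightarrow> dist z w < \<delta> \<Longrightarrow> y \<in> ell2 \<Longrightarrow>
      l2_norm (resolvent T z y) \<le> C * l2_norm y"
    using resolvent_locally_bounded[OF T w] by blast
  let ?x = "resolvent T w y"
  note x = resolvent_ell2[OF T w y]
  let ?M = "C * l2_norm ?x * l2_norm v"
  have "\<forall>\<^sub>F z in at w. z \<in> U \<inter> ball w \<delta>"
    using U C(2) by (intro eventually_at_in_open') auto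
  then have "\<forall>\<^sub>F z in at w. cmod (l2_inner (resolvent T z y) v - l2_inner ?x v) \<le> cmod (z - w) * ?M"
  proof eventually_elim
    case (elim z)
    then have z: "z \<in> op_resolvent_set T" "dist z w < \<delta>" using U by (auto simp: dist_commute)
    note zx = resolvent_ell2[OF T z(1) x]
    have "l2_inner (resolvent T z y) v = l2_inner ?x v + (z - w) * l2_inner (resolvent T z ?x) v"
      using resolvent_identity[OF T z(1) w y] l2_inner_add_left[OF x ell2_scale[OF zx] v]
        l2_inner_scale_left[OF zx v] by metis
    moreover have "cmod (l2_inner (resolvent T z ?x) v) \<le> ?M"
      using l2_Cauchy_Schwarz[OF zx v] mult_right_mono[OF C(3)[OF z x] l2_norm_nonneg[OF v]]
      by linarith
    ultimately show ?case by (simp add: norm_mult mult_left_mono)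
  qed
  moreover have "((\<lambda>z. cmod (z - w) * ?M) \<longlongrightarrow> 0) (at w)"
    by (intro tendsto_mult_left_zero tendsto_norm_zero LIM_zero tendsto_ident_at)
  ultimately have "((\<lambda>z. l2_inner (resolvent T z y) v - l2_inner ?x v) \<longlongrightarrow> 0) (at w)"
    by (rule Lim_null_comparison)
  then show ?thesis using Lim_null by blast
qed

text \<open>By the resolvent identity the difference quotient at \<open>w\<close> is \<open>\<langle>R(z) R(w) y, v\<rangle>\<close>, so weak continuity of
  the resolvent already yields the derivative \<open>\<langle>R(w)\<^sup>2 y, v\<rangle>\<close>.\<close>
lemma resolvent_holomorphic:
  assumes T: "l2_operator T" and U: "open U" "U \<subseteq> op_resolvent_set T"
    and y: "y \<in> ell2" and v: "v \<in> ell2"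
  shows "(\<lambda>z. l2_inner (resolvent T z y) v) holomorphic_on U"
  unfolding holomorphic_on_open[OF U(1)]
proof
  fix w assume "w \<in> U"
  then have w: "w \<in> op_resolvent_set T" using U by auto
  let ?x = "resolvent T w y"
  note x = resolvent_ell2[OF T w y]
  let ?f = "\<lambda>z. l2_inner (resolvent T z y) v"
  have "((\<lambda>z. (?f z - ?f w) / (z - w)) \<longlongrightarrow> l2_inner (resolvent T w ?x) v) (at w)"
  proof (rule Lim_transform_within_open[OF resolvent_weakly_continuous[OF T U \<open>w \<in> U\<close> x v] U(1) \<open>w \<in> U\<close>])
    fix z assume z': "z \<in> U" "z \<noteq> w"
    then have z: "z \<in> op_resolvent_set T" using U by auto
    note zx = resolvent_ell2[OF T z(1) x]
    have "l2_inner (resolvent T z y) v = l2_inner ?x v + (z - w) * l2_inner (resolvent T z ?x) v"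
      using resolvent_identity[OF T z(1) w y] l2_inner_add_left[OF x ell2_scale[OF zx] v]
        l2_inner_scale_left[OF zx v] by metis
    then show "l2_inner (resolvent T z ?x) v = (?f z - ?f w) / (z - w)" using z'(2) by simp
  qed
  then show "\<exists>f'. (?f has_field_derivative f') (at w)"
    unfolding has_field_derivative_iff by blast
qed

section \<open>A gap around isolated points of the spectrum\<close>

lemma resolvent_orthogonal_eigenspace:
  assumes T: "self_adjoint_op T" and z: "complex_of_real lam + \<zeta> \<in> op_resolvent_set T" "\<zeta> \<noteq> 0"
    and y: "y \<in> ell2" and e: "e \<in> op_eigenspace T (of_real lam)" and ye: "l2_inner y e = 0"
  shows "l2_inner (resolvent T (of_real lam + \<zeta>) y) e = 0"
proof -
  note op = self_adjoint_imp_l2_operator[OF T]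
  let ?x = "resolvent T (of_real lam + \<zeta>) y"
  note g = resolvent_graph[OF z(1) y]
  note x = resolvent_ell2[OF op z(1) y]
  have e': "(e, scale_seq (of_real lam) e) \<in> T" using e by (simp add: op_eigenspace_def)
  note em = l2_operatorD(1)[OF op e']
  have "l2_inner (y + scale_seq (of_real lam + \<zeta>) ?x) e = of_real lam * l2_inner ?x e"
    using self_adjoint_symmetric[OF T g e'] l2_inner_scale_right[OF x em, of "of_real lam"] by simp
  then have "(of_real lam + \<zeta>) * l2_inner ?x e = of_real lam * l2_inner ?x e"
    using l2_inner_add_left[OF y ell2_scale[OF x] em] l2_inner_scale_left[OF x em] ye by simp
  then have "\<zeta> * l2_inner ?x e = 0" by (simp add: algebra_simps)
  then show ?thesis using z(2) by simp
qed

text \<open>The vectors \<open>x\<^sub>k = \<i>s\<^sub>k (T - \<lambda> - \<i>s\<^sub>k)\<^sup>-\<^sup>1 y\<close> are bounded by \<open>\<parallel>y\<parallel>\<close> and satisfy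
  \<open>(T - \<lambda>) x\<^sub>k = \<i>s\<^sub>k (y + x\<^sub>k) \<rightarrow> 0\<close>. A weak limit is therefore an eigenvector (here the maximality of
  a self-adjoint operator enters), but it is also orthogonal to all eigenvectors, hence \<open>0\<close>.\<close>
lemma scaled_resolvent_weakly_null:
  assumes T: "self_adjoint_op T"
    and s: "\<And>k. complex_of_real lam + of_real (s k) * \<i> \<in> op_resolvent_set T"
      "\<And>k. s k \<noteq> 0" "s \<longlonglongrightarrow> 0"
    and y: "y \<in> ell2" and orth: "\<And>e. e \<in> op_eigenspace T (of_real lam) \<Longrightarrow> l2_inner y e = 0"
  obtains q :: "nat \<Rightarrow> nat" where "strict_mono q"
    "(\<lambda>k. of_real (s (q k)) * \<i> * l2_inner (resolvent T (of_real lam + of_real (s (q k)) * \<i>) y) y) \<longlonglongrightarrow> 0"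
proof -
  note op = self_adjoint_imp_l2_operator[OF T]
  define c where "c k = complex_of_real (s k) * \<i>" for k
  have c: "of_real lam + c k \<in> op_resolvent_set T" "c k \<noteq> 0" for k
    using s(1,2)[of k] by (auto simp: c_def)
  have c0: "c \<longlonglongrightarrow> 0"
    using tendsto_mult_right[OF tendsto_of_real[OF s(3), where ?'a = complex], of \<i>]
    by (simp add: c_def[abs_def])
  let ?R = "\<lambda>k. resolvent T (of_real lam + c k) y"
  define x where "x k = scale_seq (c k) (?R k)" for k
  note R = resolvent_ell2[OF op c(1) y]
  have x: "x k \<in> ell2" for k unfolding x_def by (intro ell2_scale R)
  have x_le: "l2_norm (x k) \<le> l2_norm y" for k
    using resolvent_imaginary_bound[OF T c(1) y, of k] l2_norm_scale[OF R, of "c k" k]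
    by (simp add: x_def c_def norm_mult)
  obtain z q where q: "strict_mono q" and z: "z \<in> ell2"
    and lim: "\<And>w. w \<in> ell2 \<Longrightarrow> (\<lambda>k. l2_inner (x (q k)) w) \<longlonglongrightarrow> l2_inner z w"
    by (rule l2_weakly_compact[of x "l2_norm y", OF x x_le]) (rule that)
  have cq: "(\<lambda>k. c (q k)) \<longlonglongrightarrow> 0" using LIMSEQ_subseq_LIMSEQ[OF c0 q] by (simp add: comp_def)
  \<comment> \<open>By symmetry \<open>T\<close> acts on the fixed vector \<open>u\<close> instead of \<open>x\<^sub>k\<close>, so that only weak limits are needed.\<close>
  have "(z, scale_seq (of_real lam) z) \<in> T"
  proof (rule self_adjoint_maximal[OF T z ell2_scale[OF z]])
    fix u v assume uv: "(u, v) \<in> T"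
    note mem = l2_operatorD[OF op uv]
    have eq: "l2_inner (x k) v = c k * l2_inner y u + (of_real lam + c k) * l2_inner (x k) u" for k
    proof -
      have "l2_inner (y + scale_seq (of_real lam + c k) (?R k)) u = l2_inner (?R k) v"
        by (rule self_adjoint_symmetric[OF T resolvent_graph[OF c(1) y] uv])
      then have "l2_inner (?R k) v = l2_inner y u + (of_real lam + c k) * l2_inner (?R k) u"
        using l2_inner_add_left[OF y ell2_scale[OF R] mem(1)] l2_inner_scale_left[OF R mem(1)]
        by simp
      then show ?thesis
        using l2_inner_scale_left[OF R mem(1)] l2_inner_scale_left[OF R mem(2)]
        by (simp add: x_def algebra_simps)
    qed
    have "(\<lambda>k. l2_inner (x (q k)) v) \<longlonglongrightarrow> 0 * l2_inner y u + (of_real lam + 0) * l2_inner z u"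
      unfolding eq by (intro tendsto_intros cq lim mem)
    with lim[OF mem(2)] have "l2_inner z v = of_real lam * l2_inner z u"
      using LIMSEQ_unique by fastforce
    then have "cnj (l2_inner z v) = of_real lam * cnj (l2_inner z u)" by simp
    then show "l2_inner v z = l2_inner u (scale_seq (of_real lam) z)"
      using cnj_l2_inner[OF z mem(2)] cnj_l2_inner[OF z mem(1)] l2_inner_scale_right[OF mem(1) z]
      by simp
  qed
  then have ze: "z \<in> op_eigenspace T (of_real lam)" by (simp add: op_eigenspace_def)
  have "l2_inner (x k) z = 0" for k
    using resolvent_orthogonal_eigenspace[OF T c y ze orth[OF ze], of k]
      l2_inner_scale_left[OF R z] by (simp add: x_def)
  then have "l2_inner z z = 0" using lim[OF z] by (simp add: LIMSEQ_const_iff)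
  then have "z = 0" using l2_norm_eq_0[OF z] l2_inner_self[OF z] by simp
  then have "l2_inner z y = 0" by (simp add: l2_inner_def)
  then have "(\<lambda>k. l2_inner (x (q k)) y) \<longlonglongrightarrow> 0" using lim[OF y] by simp
  then have "(\<lambda>k. c (q k) * l2_inner (?R (q k)) y) \<longlonglongrightarrow> 0"
    using l2_inner_scale_left[OF R y] by (simp add: x_def)
  then show thesis using that[OF q] by (simp add: c_def)
qed

text \<open>Pairing \<open>(T - \<lambda>) y\<close> with \<open>x = (T - \<lambda> - \<i>t)\<^sup>-\<^sup>1 y\<close> gives
  \<open>\<parallel>y\<parallel>\<^sup>2 = \<langle>(T - \<lambda>) y, x\<rangle> + \<i>t \<langle>y, x\<rangle>\<close>. The last term is at most \<open>4 t \<parallel>y\<parallel>\<^sup>2 / r\<close> because the singularity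
  at \<open>\<lambda>\<close> is removable; at \<open>t = r / 8\<close> this is half of the left-hand side, while \<open>\<parallel>x\<parallel> \<le> \<parallel>y\<parallel> / t\<close>.\<close>
lemma isolated_point_gap:
  assumes T: "self_adjoint_op T" and r: "0 < r"
    and res: "ball (complex_of_real lam) r - {of_real lam} \<subseteq> op_resolvent_set T"
    and yw: "(y, w) \<in> T"
    and orth: "\<And>e. e \<in> op_eigenspace T (of_real lam) \<Longrightarrow> l2_inner y e = 0"
  shows "r / 16 * l2_norm y \<le> l2_norm (w - scale_seq (of_real lam) y)"
proof -
  note op = self_adjoint_imp_l2_operator[OF T]
  note mem = l2_operatorD[OF op yw]
  note y = mem(1)
  let ?f = "\<lambda>\<zeta>. l2_inner (resolvent T (of_real lam + \<zeta>) y) y"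
  let ?K = "(l2_norm y)\<^sup>2"
  have shift: "of_real lam + \<zeta> \<in> op_resolvent_set T" if "\<zeta> \<in> ball 0 r - {0}" for \<zeta>
    using that res by (auto simp: dist_norm)
  have "(\<lambda>z. l2_inner (resolvent T z y) y) \<circ> (\<lambda>\<zeta>. of_real lam + \<zeta>) holomorphic_on ball 0 r - {0}"
  proof (rule holomorphic_on_compose_gen[where t = "ball (complex_of_real lam) r - {of_real lam}"])
    show "(\<lambda>z. l2_inner (resolvent T z y) y) holomorphic_on ball (of_real lam) r - {of_real lam}"
      by (rule resolvent_holomorphic[OF op _ res y y]) auto
    show "(\<lambda>\<zeta>. of_real lam + \<zeta>) holomorphic_on ball 0 r - {0}"
      by (intro holomorphic_intros)
  qed (auto simp: dist_norm)
  then have hol: "?f holomorphic_on ball 0 r - {0}" by (simp add: comp_def)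
  have bound: "\<bar>Im \<zeta>\<bar> * cmod (?f \<zeta>) \<le> ?K" if "\<zeta> \<in> ball 0 r - {0}" for \<zeta>
  proof -
    note z = shift[OF that]
    have "\<bar>Im \<zeta>\<bar> * cmod (?f \<zeta>) \<le> \<bar>Im \<zeta>\<bar> * (l2_norm (resolvent T (of_real lam + \<zeta>) y) * l2_norm y)"
      by (intro mult_left_mono l2_Cauchy_Schwarz resolvent_ell2[OF op z] y) auto
    also have "\<dots> \<le> l2_norm y * l2_norm y"
      using resolvent_imaginary_bound[OF T z y] l2_norm_nonneg[OF y]
      by (simp add: mult.assoc[symmetric] mult_right_mono)
    finally show ?thesis by (simp add: power2_eq_square)
  qed
  \<comment> \<open>Any null sequence will do, as long as it stays inside the punctured disc.\<close>
  define s where "s k = r / (2 + real k)" for k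
  have s: "s k \<noteq> 0" "\<bar>s k\<bar> < r" for k
    using r by (auto simp: s_def divide_simps)
  have s0: "s \<longlonglongrightarrow> 0" unfolding s_def by real_asymp
  have sres: "of_real lam + of_real (s k) * \<i> \<in> op_resolvent_set T" for k
    using s[of k] by (intro shift) (auto simp: norm_mult)
  obtain q where q: "strict_mono q" "(\<lambda>k. of_real (s (q k)) * \<i> * ?f (of_real (s (q k)) * \<i>)) \<longlonglongrightarrow> 0"
    using scaled_resolvent_weakly_null[OF T sres s(1) s0 y orth] by blast
  have sq: "(\<lambda>k. complex_of_real (s (q k)) * \<i>) \<longlonglongrightarrow> 0"
    using tendsto_mult_right[OF tendsto_of_real[OF LIMSEQ_subseq_LIMSEQ[OF s0 q(1)], where ?'a = complex], of \<i>]
    by (simp add: comp_def)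
  define t where "t = r / 8"
  have t: "0 < t" using r by (simp add: t_def)
  have "r / 2 * cmod (?f (of_real t * \<i>)) \<le> 2 * ?K"
    by (rule removable_singularity_bound[OF hol bound _ sq q(2)]) (use r s(1) in \<open>auto simp: t_def\<close>)
  then have f: "t * cmod (?f (of_real t * \<i>)) \<le> ?K / 2" by (simp add: t_def)
  define z where "z = complex_of_real lam + of_real t * \<i>"
  have z: "z \<in> op_resolvent_set T"
    unfolding z_def using r by (intro shift) (auto simp: t_def norm_mult)
  let ?x = "resolvent T z y" and ?v = "w - scale_seq (of_real lam) y"
  note x = resolvent_ell2[OF op z y]
  have v: "?v \<in> ell2" by (intro ell2_diff ell2_scale mem)
  have nx: "t * l2_norm ?x \<le> l2_norm y"
    using resolvent_imaginary_bound[OF T z y] t by (simp add: z_def)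
  have "l2_inner w ?x = l2_inner y (y + scale_seq z ?x)"
    by (rule self_adjoint_symmetric[OF T yw resolvent_graph[OF z y]])
  also have "\<dots> = cnj (l2_inner (y + scale_seq z ?x) y)"
    by (rule cnj_l2_inner[symmetric]) (intro ell2_add ell2_scale x y)+
  also have "\<dots> = of_real ?K + cnj z * l2_inner y ?x"
    using l2_inner_add_left[OF y ell2_scale[OF x] y] l2_inner_scale_left[OF x y]
      l2_inner_self[OF y] cnj_l2_inner[OF x y] by simp
  finally have "l2_inner w ?x = of_real ?K + cnj z * l2_inner y ?x" .
  moreover have "l2_inner ?v ?x = l2_inner w ?x - of_real lam * l2_inner y ?x"
    using l2_inner_diff_left[OF mem(2) ell2_scale[OF y] x] l2_inner_scale_left[OF y x] by simp
  moreover have "cnj z = of_real lam - of_real t * \<i>" by (simp add: z_def)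
  ultimately have "l2_inner ?v ?x = of_real ?K - of_real t * \<i> * l2_inner y ?x"
    by (simp add: left_diff_distrib)
  then have "complex_of_real ?K = l2_inner ?v ?x + of_real t * \<i> * l2_inner y ?x" by simp
  then have "cmod (complex_of_real ?K) \<le> cmod (l2_inner ?v ?x) + cmod (of_real t * \<i> * l2_inner y ?x)"
    by (metis norm_triangle_ineq)
  then have "?K \<le> cmod (l2_inner ?v ?x) + t * cmod (l2_inner ?x y)"
    using t cnj_l2_inner[OF x y] by (metis abs_of_pos complex_mod_cnj norm_ii norm_mult norm_of_real
        abs_of_nonneg mult.right_neutral zero_le_power2)
  also have "\<dots> \<le> l2_norm ?v * l2_norm ?x + ?K / 2"
    using l2_Cauchy_Schwarz[OF v x] f by (simp add: z_def)
  finally have "?K / 2 \<le> l2_norm ?v * l2_norm ?x" by simp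
  then have "t * (?K / 2) \<le> t * (l2_norm ?v * l2_norm ?x)" using t by (intro mult_left_mono) auto
  also have "\<dots> \<le> l2_norm ?v * l2_norm y"
    using mult_left_mono[OF nx l2_norm_nonneg[OF v]] by (simp add: mult.left_commute)
  finally have "l2_norm y * (r / 16 * l2_norm y) \<le> l2_norm y * l2_norm ?v"
    by (simp add: t_def power2_eq_square algebra_simps)
  then show ?thesis
    using l2_norm_nonneg[OF y] l2_norm_nonneg[OF v] by (cases "l2_norm y = 0") auto
qed

text \<open>The spanning set \<open>D\<close> may contain sequences outside \<^const>\<open>ell2\<close>, for which inner products are
  meaningless; a basis chosen inside \<open>E\<close> replaces it.\<close>
lemma finite_dimensional_orthogonality:
  assumes E: "E \<subseteq> ell2" "finite D" "E \<subseteq> cseq.span D"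
  obtains B where "finite B" "B \<subseteq> E"
    "\<And>x e. x \<in> ell2 \<Longrightarrow> (\<And>b. b \<in> B \<Longrightarrow> l2_inner x b = 0) \<Longrightarrow> e \<in> E \<Longrightarrow> l2_inner x e = 0"
proof -
  obtain B where B: "B \<subseteq> E" "cseq.independent B" "E \<subseteq> cseq.span B"
    using cseq.basis_exists[of E] by metis
  have "finite B" using cseq.independent_span_bound[OF E(2) B(2)] B(1) E(3) by auto
  moreover have "l2_inner x e = 0"
    if x: "x \<in> ell2" and xB: "\<And>b. b \<in> B \<Longrightarrow> l2_inner x b = 0" and e: "e \<in> E" for x e
  proof -
    have zero: "l2_inner x v = 0 \<longleftrightarrow> l2_inner v x = 0" if "v \<in> ell2" for v
      using cnj_l2_inner[OF x that] by (metis complex_cnj_zero_iff)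
    have "e \<in> cseq.span B" using e B(3) by auto
    then have "e \<in> ell2 \<and> l2_inner e x = 0"
    proof (rule cseq.span_induct)
      show "cseq.subspace {v. v \<in> ell2 \<and> l2_inner v x = 0}"
        unfolding cseq.subspace_def using x
        by (auto simp: ell2_zero ell2_add ell2_scale l2_inner_add_left l2_inner_scale_left)
          (simp add: l2_inner_def)
      show "b \<in> ell2 \<and> l2_inner b x = 0" if "b \<in> B" for b
        using that xB zero B(1) E(1) by blast
    qed
    then show ?thesis using zero by blast
  qed
  ultimately show thesis using that B(1) by blast
qed

proposition bounded_below_off_essential_spectrum:
  assumes T: "self_adjoint_op T" and lam: "complex_of_real lam \<notin> essential_spectrum T"
  obtains B c where "finite B" "B \<subseteq> ell2" "0 < c"
    "\<And>x w. (x, w) \<in> T \<Longrightarrow> (\<And>b. b \<in> B \<Longrightarrow> l2_inner x b = 0) \<Longrightarrow>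
      c * l2_norm x \<le> l2_norm (w - scale_seq (of_real lam) x)"
proof (cases "complex_of_real lam \<in> op_resolvent_set T")
  case True
  note op = self_adjoint_imp_l2_operator[OF T]
  obtain C where C: "0 < C"
    "\<And>x w. (x, w) \<in> T \<Longrightarrow> l2_norm x \<le> C * l2_norm (w - scale_seq (of_real lam) x)"
  proof -
    obtain C0 where C0: "\<And>x w. (x, w) \<in> T \<Longrightarrow> l2_norm x \<le> C0 * l2_norm (w - scale_seq (of_real lam) x)"
      using True unfolding op_resolvent_set_def by blast
    have "l2_norm x \<le> (\<bar>C0\<bar> + 1) * l2_norm (w - scale_seq (of_real lam) x)" if "(x, w) \<in> T" for x w
    proof -
      note mem = l2_operatorD[OF op that]
      have "0 \<le> l2_norm (w - scale_seq (of_real lam) x)"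
        by (intro l2_norm_nonneg ell2_diff ell2_scale mem)
      then have "C0 * l2_norm (w - scale_seq (of_real lam) x)
          \<le> (\<bar>C0\<bar> + 1) * l2_norm (w - scale_seq (of_real lam) x)"
        by (intro mult_right_mono) auto
      with C0[OF that] show ?thesis by linarith
    qed
    then show thesis using that[of "\<bar>C0\<bar> + 1"] by auto
  qed
  show thesis
    by (rule that[of "{}" "1 / C"]) (use C in \<open>auto simp: field_simps\<close>)
next
  case False
  note op = self_adjoint_imp_l2_operator[OF T]
  let ?E = "op_eigenspace T (of_real lam)"
  have d: "complex_of_real lam \<in> discrete_spectrum T"
    using False lam by (auto simp: essential_spectrum_def op_spectrum_def)
  then obtain r where r: "0 < r"
    "\<And>z. z \<in> op_spectrum T \<Longrightarrow> dist (of_real lam) z < r \<Longrightarrow> z = of_real lam"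
    by (auto simp: discrete_spectrum_def isolated_in_dist_Ex_iff)
  then have res: "ball (of_real lam) r - {of_real lam} \<subseteq> op_resolvent_set T"
    by (force simp: op_spectrum_def)
  have "?E \<subseteq> ell2" using l2_operatorD(1)[OF op] by (auto simp: op_eigenspace_def)
  moreover obtain D where "finite D" "?E \<subseteq> cseq.span D"
    using d by (auto simp: discrete_spectrum_def)
  ultimately obtain B where B: "finite B" "B \<subseteq> ?E"
    "\<And>x e. x \<in> ell2 \<Longrightarrow> (\<And>b. b \<in> B \<Longrightarrow> l2_inner x b = 0) \<Longrightarrow> e \<in> ?E \<Longrightarrow> l2_inner x e = 0"
    using finite_dimensional_orthogonality[of ?E D] by metis
  show thesis
  proof (rule that[of B "r / 16"])
    fix x w assume xw: "(x, w) \<in> T" and xB: "\<And>b. b \<in> B \<Longrightarrow> l2_inner x b = 0"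
    show "r / 16 * l2_norm x \<le> l2_norm (w - scale_seq (of_real lam) x)"
      by (rule isolated_point_gap[OF T r(1) res xw])
        (rule B(3)[OF l2_operatorD(1)[OF op xw] xB])
  qed (use B r(1) \<open>?E \<subseteq> ell2\<close> in auto)
qed

section \<open>Eigenvalues of the truncations\<close>

text \<open>Gaussian elimination: an equation with a nonzero coefficient at \<open>p\<close> is used to eliminate the unknown
  at \<open>p\<close> from the remaining equations.\<close>
lemma underdetermined_system_solution:
  fixes \<phi> :: "'k \<Rightarrow> 'i \<Rightarrow> 'a :: field"
  assumes "finite K" "finite S" "card K < card S"
  obtains c where "\<exists>i\<in>S. c i \<noteq> 0" "\<And>k. k \<in> K \<Longrightarrow> (\<Sum>i\<in>S. c i * \<phi> k i) = 0"
proof -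
  have "\<exists>c. (\<exists>i\<in>S. c i \<noteq> 0) \<and> (\<forall>k\<in>K. (\<Sum>i\<in>S. c i * \<phi> k i) = 0)"
    using assms
  proof (induction K arbitrary: S \<phi> rule: finite_induct)
    case empty
    then obtain i where "i \<in> S" by (metis card.empty card_gt_0_iff equals0I)
    then show ?case by (intro exI[of _ "\<lambda>_. 1"]) auto
  next
    case (insert k K)
    show ?case
    proof (cases "\<forall>i\<in>S. \<phi> k i = 0")
      case True
      have "card K < card S" using insert by simp
      from insert.IH[OF insert.prems(1) this, of \<phi>] True show ?thesis by auto
    next
      case False
      then obtain p where p: "p \<in> S" "\<phi> k p \<noteq> 0" by blast
      define \<psi> where "\<psi> m i = \<phi> m i - \<phi> m p * \<phi> k i / \<phi> k p" for m i
      have "card K < card (S - {p})" using insert p by simp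
      from insert.IH[OF _ this, of \<psi>] insert.prems(1) obtain c
        where c: "\<exists>i\<in>S - {p}. c i \<noteq> 0" "\<And>m. m \<in> K \<Longrightarrow> (\<Sum>i\<in>S - {p}. c i * \<psi> m i) = 0"
        by auto
      let ?s = "\<Sum>i\<in>S - {p}. c i * \<phi> k i"
      define d where "d i = (if i = p then - ?s / \<phi> k p else c i)" for i
      have split: "(\<Sum>i\<in>S. d i * \<phi> m i) = - ?s / \<phi> k p * \<phi> m p + (\<Sum>i\<in>S - {p}. c i * \<phi> m i)" for m
        using insert.prems(1) p(1) by (simp add: sum.remove[of S p] d_def)
      have "(\<Sum>i\<in>S. d i * \<phi> m i) = 0" if "m \<in> insert k K" for m
      proof (cases "m = k")
        case True
        then show ?thesis using split p(2) by simp
      next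
        case False
        have "(\<Sum>i\<in>S - {p}. c i * \<psi> m i) = (\<Sum>i\<in>S - {p}. c i * \<phi> m i) - \<phi> m p / \<phi> k p * ?s"
          by (simp add: \<psi>_def right_diff_distrib sum_subtractf sum_distrib_left ac_simps)
        then show ?thesis using c(2)[of m] False that split[of m] by simp
      qed
      moreover have "\<exists>i\<in>S. d i \<noteq> 0" using c(1) by (auto simp: d_def)
      ultimately show ?thesis by blast
    qed
  qed
  then show thesis using that by blast
qed

lemma jacobi_truncation_eigenvector:
  assumes "\<mu> \<in> spectrum (jacobi_truncation a b N)"
  obtains g :: "nat \<Rightarrow> real" where "\<exists>i<N. g i \<noteq> 0" "\<And>i. N \<le> i \<Longrightarrow> g i = 0"
    "\<And>i. i < N \<Longrightarrow> (\<Sum>j<N. jacobi_matrix a b i j * g j) = \<mu> * g i"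
proof -
  let ?A = "jacobi_truncation a b N"
  have dim: "dim_row ?A = N" by (simp add: jacobi_truncation_def)
  obtain v where v: "v \<in> carrier_vec N" "v \<noteq> 0\<^sub>v N" "?A *\<^sub>v v = \<mu> \<cdot>\<^sub>v v"
    using assms by (auto simp: spectrum_def eigenvalue_def eigenvector_def dim)
  define g where "g i = (if i < N then vec_index v i else 0)" for i
  show thesis
  proof (rule that[of g])
    show "\<exists>i<N. g i \<noteq> 0" using v(1,2) by (auto simp: g_def vec_eq_iff)
    show "(\<Sum>j<N. jacobi_matrix a b i j * g j) = \<mu> * g i" if i: "i < N" for i
    proof -
      have "vec_index (?A *\<^sub>v v) i = (\<Sum>j<N. jacobi_matrix a b i j * g j)"
        using i v(1) by (simp add: jacobi_truncation_def scalar_prod_def g_def atLeast0LessThan)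
      then show ?thesis using v i by (simp add: g_def)
    qed
  qed (simp add: g_def)
qed

lemma jacobi_matrix_commute: "jacobi_matrix a b i j = jacobi_matrix a b j i"
  by (auto simp: jacobi_matrix_def)

lemma symmetric_eigenvectors_orthogonal:
  fixes g h :: "nat \<Rightarrow> real"
  assumes sym: "\<And>i j. J i j = J j i"
    and g: "\<And>i. i < N \<Longrightarrow> (\<Sum>j<N. J i j * g j) = \<mu> * g i"
    and h: "\<And>i. i < N \<Longrightarrow> (\<Sum>j<N. J i j * h j) = \<nu> * h i"
    and "\<mu> \<noteq> \<nu>"
  shows "(\<Sum>i<N. g i * h i) = 0"
proof -
  have "\<mu> * (\<Sum>i<N. g i * h i) = (\<Sum>i<N. (\<mu> * g i) * h i)"
    by (simp add: sum_distrib_left mult.assoc)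
  also have "\<dots> = (\<Sum>i<N. \<Sum>j<N. J i j * g j * h i)"
    by (intro sum.cong refl) (simp add: g[symmetric] sum_distrib_right)
  also have "\<dots> = (\<Sum>j<N. \<Sum>i<N. J i j * g j * h i)" by (rule sum.swap)
  also have "\<dots> = (\<Sum>j<N. g j * (\<nu> * h j))"
    by (intro sum.cong refl) (simp add: h[symmetric] sum_distrib_left sym ac_simps)
  also have "\<dots> = \<nu> * (\<Sum>i<N. g i * h i)"
    by (simp add: sum_distrib_left ac_simps)
  finally show ?thesis using \<open>\<mu> \<noteq> \<nu>\<close> by simp
qed

lemma sum_norm_square_orthogonal_family:
  fixes g :: "'k \<Rightarrow> 'i \<Rightarrow> real" and d :: "'k \<Rightarrow> complex"
  assumes S: "finite S"
    and orth: "\<And>\<mu> \<nu>. \<mu> \<in> S \<Longrightarrow> \<nu> \<in> S \<Longrightarrow> \<mu> \<noteq> \<nu> \<Longrightarrow> (\<Sum>i\<in>I. g \<mu> i * g \<nu> i) = 0"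
  shows "(\<Sum>i\<in>I. (cmod (\<Sum>\<mu>\<in>S. d \<mu> * of_real (g \<mu> i)))\<^sup>2)
       = (\<Sum>\<mu>\<in>S. (cmod (d \<mu>))\<^sup>2 * (\<Sum>i\<in>I. (g \<mu> i)\<^sup>2))"
proof -
  have "complex_of_real (\<Sum>i\<in>I. (cmod (\<Sum>\<mu>\<in>S. d \<mu> * of_real (g \<mu> i)))\<^sup>2)
      = (\<Sum>i\<in>I. (\<Sum>\<mu>\<in>S. d \<mu> * of_real (g \<mu> i)) * cnj (\<Sum>\<nu>\<in>S. d \<nu> * of_real (g \<nu> i)))"
    by (simp only: of_real_sum complex_norm_square)
  also have "\<dots> = (\<Sum>i\<in>I. \<Sum>\<mu>\<in>S. \<Sum>\<nu>\<in>S. d \<mu> * cnj (d \<nu>) * of_real (g \<mu> i * g \<nu> i))"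
    by (simp add: sum_product ac_simps)
  also have "\<dots> = (\<Sum>\<mu>\<in>S. \<Sum>\<nu>\<in>S. \<Sum>i\<in>I. d \<mu> * cnj (d \<nu>) * of_real (g \<mu> i * g \<nu> i))"
    by (subst sum.swap) (intro sum.cong refl sum.swap)
  also have "\<dots> = (\<Sum>\<mu>\<in>S. \<Sum>\<nu>\<in>S. d \<mu> * cnj (d \<nu>) * of_real (\<Sum>i\<in>I. g \<mu> i * g \<nu> i))"
    by (simp add: sum_distrib_left)
  also have "\<dots> = (\<Sum>\<mu>\<in>S. \<Sum>\<nu>\<in>S. if \<nu> = \<mu> then d \<mu> * cnj (d \<mu>) * of_real (\<Sum>i\<in>I. (g \<mu> i)\<^sup>2) else 0)"
    using orth by (intro sum.cong refl) (simp add: power2_eq_square del: of_real_sum of_real_mult)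
  also have "\<dots> = complex_of_real (\<Sum>\<mu>\<in>S. (cmod (d \<mu>))\<^sup>2 * (\<Sum>i\<in>I. (g \<mu> i)\<^sup>2))"
    using S by (simp add: complex_norm_square[symmetric] del: of_real_power)
  finally show ?thesis by (simp only: of_real_eq_iff)
qed

lemma l2_norm_finite_support:
  assumes "\<And>n. N \<le> n \<Longrightarrow> x n = 0"
  shows "(l2_norm x)\<^sup>2 = (\<Sum>n<N. (cmod (x n))\<^sup>2)"
proof -
  have "(\<Sum>n. (cmod (x n))\<^sup>2) = (\<Sum>n<N. (cmod (x n))\<^sup>2)"
    by (rule suminf_finite) (use assms in \<open>auto simp: not_less\<close>)
  then show ?thesis by (simp add: l2_norm_def sum_nonneg)
qed

lemma jacobi_mult_support:
  assumes "\<And>j. N \<le> j \<Longrightarrow> x j = 0"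
  shows "jacobi_mult a b x i = (\<Sum>j<N. of_real (jacobi_matrix a b i j) * x j)"
  unfolding jacobi_mult_def
proof (rule sum.mono_neutral_left)
  show "{j. x j \<noteq> 0} \<subseteq> {..<N}" using assms by (auto simp: not_le[symmetric])
qed auto

lemma jacobi_mult_in_extension:
  assumes ext: "jacobi_operator a b \<subseteq> T" and x: "\<And>j. N \<le> j \<Longrightarrow> x j = 0"
  shows "(x, jacobi_mult a b x) \<in> T"
proof -
  have "jacobi_mult a b x i = 0" if "Suc N \<le> i" for i
    using that x by (auto simp: jacobi_mult_support[OF x] jacobi_matrix_def intro!: sum.neutral)
  then have "jacobi_mult a b x \<in> ell2" by (rule ell2_finite_support)
  moreover have "x \<in> ell2" using x by (rule ell2_finite_support)
  moreover have "x \<in> finitely_supported"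
    unfolding finitely_supported_def
    using finite_subset[of "{n. x n \<noteq> 0}" "{..<N}"] x by (force simp: not_le[symmetric])
  ultimately have "(x, jacobi_mult a b x) \<in> jacobi_operator a b"
    unfolding jacobi_operator_def op_closure_def by (auto simp: l2_norm_zero intro!: exI[of _ x])
  then show ?thesis using ext by blast
qed

text \<open>A combination of the eigenvectors is subject to \<open>card B + 1\<close> linear conditions: orthogonality to
  \<open>B\<close>, and last entry \<open>0\<close>. With more unknowns than conditions there is a nonzero solution \<open>x\<close>. The
  entry of \<open>T x\<close> just beyond the truncation is the last entry of \<open>x\<close> times an off-diagonal
  coefficient, so it vanishes too. As the eigenvectors are orthogonal and the eigenvalues are within
  \<open>c / 2\<close> of \<open>\<lambda>\<close>, the norm of \<open>(T - \<lambda>) x\<close> is at most \<open>c / 2\<close> times that of \<open>x\<close>.\<close>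
proposition few_truncation_eigenvalues_nearby:
  assumes ext: "jacobi_operator a b \<subseteq> T" and B: "finite B" and c: "0 < c"
    and below: "\<And>x w. (x, w) \<in> T \<Longrightarrow> (\<And>v. v \<in> B \<Longrightarrow> l2_inner x v = 0) \<Longrightarrow>
      c * l2_norm x \<le> l2_norm (w - scale_seq (of_real lam) x)"
  shows "card (spectrum (jacobi_truncation a b (Suc n)) \<inter> ball lam (c / 2)) \<le> card B + 1"
proof (rule ccontr)
  let ?N = "Suc n"
  define S where "S = spectrum (jacobi_truncation a b ?N) \<inter> ball lam (c / 2)"
  assume "\<not> ?thesis"
  then have cardS: "card B + 1 < card S" by (simp add: S_def)
  then have S: "finite S" using card.infinite by fastforce
  have "\<exists>g :: nat \<Rightarrow> real. (\<exists>i<?N. g i \<noteq> 0) \<and> (\<forall>i\<ge>?N. g i = 0) \<and>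
      (\<forall>i<?N. (\<Sum>j<?N. jacobi_matrix a b i j * g j) = \<mu> * g i)" if "\<mu> \<in> S" for \<mu>
    by (rule jacobi_truncation_eigenvector[of \<mu> a b ?N]) (use that S_def in blast)+
  then obtain g :: "real \<Rightarrow> nat \<Rightarrow> real" where g: "\<And>\<mu>. \<mu> \<in> S \<Longrightarrow> \<exists>i<?N. g \<mu> i \<noteq> 0"
    "\<And>\<mu> i. \<mu> \<in> S \<Longrightarrow> ?N \<le> i \<Longrightarrow> g \<mu> i = 0"
    "\<And>\<mu> i. \<mu> \<in> S \<Longrightarrow> i < ?N \<Longrightarrow> (\<Sum>j<?N. jacobi_matrix a b i j * g \<mu> j) = \<mu> * g \<mu> i"
    by metis
  have orth: "(\<Sum>i<?N. g \<mu> i * g \<nu> i) = 0" if "\<mu> \<in> S" "\<nu> \<in> S" "\<mu> \<noteq> \<nu>" for \<mu> \<nu>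
    by (rule symmetric_eigenvectors_orthogonal[where J = "jacobi_matrix a b" and \<mu> = \<mu> and \<nu> = \<nu>])
      (use that g(3) jacobi_matrix_commute in auto)
  \<comment> \<open>The index \<open>None\<close> stands for the condition on the last entry, \<open>Some v\<close> for orthogonality to \<open>v\<close>.\<close>
  define \<phi> where "\<phi> k \<mu> = (case k of None \<Rightarrow> complex_of_real (g \<mu> n)
      | Some v \<Rightarrow> \<Sum>i<?N. of_real (g \<mu> i) * cnj (v i))" for k \<mu>
  have "card (insert None (Some ` B)) = card B + 1"
    using B by (simp add: card_image)
  then obtain d where d: "\<exists>\<mu>\<in>S. d \<mu> \<noteq> 0"
    "\<And>k. k \<in> insert None (Some ` B) \<Longrightarrow> (\<Sum>\<mu>\<in>S. d \<mu> * \<phi> k \<mu>) = 0"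
    using underdetermined_system_solution[of "insert None (Some ` B)" S \<phi>] B S cardS by auto
  define x where "x i = (\<Sum>\<mu>\<in>S. d \<mu> * of_real (g \<mu> i))" for i
  define y where "y i = (\<Sum>\<mu>\<in>S. (d \<mu> * of_real (\<mu> - lam)) * of_real (g \<mu> i))" for i
  have x0: "x i = 0" and y0: "y i = 0" if "?N \<le> i" for i
    using that g(2) by (simp_all add: x_def y_def)
  have xn: "x n = 0" using d(2)[of None] by (simp add: \<phi>_def x_def)
  have mult_x: "jacobi_mult a b x i = (\<Sum>j<?N. of_real (jacobi_matrix a b i j) * x j)" for i
    by (rule jacobi_mult_support) (rule x0)
  have graph: "(x, jacobi_mult a b x) \<in> T"
    by (rule jacobi_mult_in_extension[OF ext]) (rule x0)
  have x_ell2: "x \<in> ell2" by (rule ell2_finite_support) (rule x0)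
  have "l2_inner x v = 0" if v: "v \<in> B" for v
  proof -
    have "l2_inner x v = (\<Sum>i<?N. x i * cnj (v i))"
      unfolding l2_inner_def by (rule suminf_finite) (use x0 in \<open>auto simp: not_less\<close>)
    also have "\<dots> = (\<Sum>\<mu>\<in>S. d \<mu> * \<phi> (Some v) \<mu>)"
      unfolding x_def \<phi>_def option.case sum_distrib_right sum_distrib_left mult.assoc
      by (rule sum.swap)
    finally show ?thesis using d(2)[of "Some v"] v by simp
  qed
  from below[OF graph this]
  have "c * l2_norm x \<le> l2_norm (jacobi_mult a b x - scale_seq (of_real lam) x)" by simp
  also have "jacobi_mult a b x - scale_seq (of_real lam) x = y"
  proof
    fix i
    have "jacobi_mult a b x i = y i + of_real lam * x i"
    proof (cases "i < ?N")
      case True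
      have "jacobi_mult a b x i
          = (\<Sum>j<?N. \<Sum>\<mu>\<in>S. of_real (jacobi_matrix a b i j) * (d \<mu> * of_real (g \<mu> j)))"
        unfolding mult_x by (intro sum.cong refl) (simp only: x_def sum_distrib_left)
      also have "\<dots> = (\<Sum>\<mu>\<in>S. \<Sum>j<?N. of_real (jacobi_matrix a b i j) * (d \<mu> * of_real (g \<mu> j)))"
        by (rule sum.swap)
      also have "\<dots> = (\<Sum>\<mu>\<in>S. d \<mu> * of_real (\<Sum>j<?N. jacobi_matrix a b i j * g \<mu> j))"
        unfolding of_real_sum sum_distrib_left by (intro sum.cong refl) (simp add: ac_simps)
      also have "\<dots> = (\<Sum>\<mu>\<in>S. d \<mu> * of_real (\<mu> * g \<mu> i))"
        using g(3) True by (intro sum.cong refl) (simp del: sum.lessThan_Suc)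
      also have "\<dots> = y i + of_real lam * x i"
        unfolding x_def y_def sum_distrib_left sum.distrib[symmetric]
        by (intro sum.cong refl) (simp add: algebra_simps)
      finally show ?thesis .
    next
      case False
      have "of_real (jacobi_matrix a b i j) * x j = 0" if "j < ?N" for j
        using that False xn by (cases "j = n") (auto simp: jacobi_matrix_def)
      then have "jacobi_mult a b x i = 0"
        unfolding mult_x by (intro sum.neutral) auto
      then show ?thesis using x0 y0 False by simp
    qed
    then show "(jacobi_mult a b x - scale_seq (of_real lam) x) i = y i"
      by (simp add: scale_seq_def)
  qed
  finally have le: "c * l2_norm x \<le> l2_norm y" .
  define m where "m \<mu> = (\<Sum>i<?N. (g \<mu> i)\<^sup>2)" for \<mu>
  have m: "0 < m \<mu>" if \<mu>: "\<mu> \<in> S" for \<mu>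
  proof -
    from g(1)[OF \<mu>] obtain i where "i \<in> {..<?N}" "g \<mu> i \<noteq> 0" by blast
    then show ?thesis unfolding m_def by (intro sum_pos2[of "{..<?N}" i]) auto
  qed
  have "(l2_norm x)\<^sup>2 = (\<Sum>i<?N. (cmod (x i))\<^sup>2)"
    by (rule l2_norm_finite_support) (rule x0)
  also have "\<dots> = (\<Sum>\<mu>\<in>S. (cmod (d \<mu>))\<^sup>2 * m \<mu>)"
    unfolding x_def m_def
    by (rule sum_norm_square_orthogonal_family[OF S orth])
  finally have nx: "(l2_norm x)\<^sup>2 = (\<Sum>\<mu>\<in>S. (cmod (d \<mu>))\<^sup>2 * m \<mu>)" .
  have "(l2_norm y)\<^sup>2 = (\<Sum>i<?N. (cmod (y i))\<^sup>2)"
    by (rule l2_norm_finite_support) (rule y0)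
  also have "\<dots> = (\<Sum>\<mu>\<in>S. (cmod (d \<mu> * of_real (\<mu> - lam)))\<^sup>2 * m \<mu>)"
    unfolding y_def m_def
    by (rule sum_norm_square_orthogonal_family[OF S orth])
  also have "\<dots> \<le> (\<Sum>\<mu>\<in>S. (c / 2)\<^sup>2 * ((cmod (d \<mu>))\<^sup>2 * m \<mu>))"
  proof (rule sum_mono)
    fix \<mu> assume \<mu>: "\<mu> \<in> S"
    then have "\<bar>\<mu> - lam\<bar> \<le> c / 2" by (auto simp: S_def dist_real_def abs_minus_commute)
    then have "\<bar>\<mu> - lam\<bar>\<^sup>2 \<le> (c / 2)\<^sup>2" by (intro power_mono) auto
    then have "\<bar>\<mu> - lam\<bar>\<^sup>2 * ((cmod (d \<mu>))\<^sup>2 * m \<mu>) \<le> (c / 2)\<^sup>2 * ((cmod (d \<mu>))\<^sup>2 * m \<mu>)"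
      using m[OF \<mu>] by (intro mult_right_mono) auto
    then show "(cmod (d \<mu> * of_real (\<mu> - lam)))\<^sup>2 * m \<mu> \<le> (c / 2)\<^sup>2 * ((cmod (d \<mu>))\<^sup>2 * m \<mu>)"
      unfolding norm_mult norm_of_real power_mult_distrib by (simp add: ac_simps)
  qed
  also have "\<dots> = (c / 2)\<^sup>2 * (l2_norm x)\<^sup>2" by (simp only: nx sum_distrib_left)
  finally have "(l2_norm y)\<^sup>2 \<le> (c / 2)\<^sup>2 * (l2_norm x)\<^sup>2" .
  moreover have "(c * l2_norm x)\<^sup>2 \<le> (l2_norm y)\<^sup>2"
    using le c l2_norm_nonneg[OF x_ell2] by (intro power_mono) auto
  moreover have pos: "0 < (l2_norm x)\<^sup>2"
  proof -
    from d(1) obtain \<mu> where "\<mu> \<in> S" "d \<mu> \<noteq> 0" by blast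
    then show ?thesis unfolding nx using m S
      by (intro sum_pos2[of S \<mu>]) (auto simp: less_imp_le)
  qed
  ultimately have "c\<^sup>2 * (l2_norm x)\<^sup>2 \<le> c\<^sup>2 / 4 * (l2_norm x)\<^sup>2"
    by (simp add: power_mult_distrib power_divide)
  then show False using pos c by simp
qed

proposition truncation_eigenvalue_count_bounded:
  assumes T: "self_adjoint_op T" and ext: "jacobi_operator a b \<subseteq> T"
    and K: "compact K" "\<And>lam. lam \<in> K \<Longrightarrow> complex_of_real lam \<notin> essential_spectrum T"
  obtains M where "\<And>n. card (spectrum (jacobi_truncation a b (Suc n)) \<inter> K) \<le> M"
proof -
  let ?\<sigma> = "\<lambda>n. spectrum (jacobi_truncation a b (Suc n))"
  have fin: "finite (?\<sigma> n)" for n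
    by (rule card_finite_spectrum[of _ "Suc n"]) (simp add: jacobi_truncation_def)
  have "\<exists>\<delta>>0. \<exists>m. \<forall>n. card (?\<sigma> n \<inter> ball lam \<delta>) \<le> m" if lam: "lam \<in> K" for lam
  proof -
    obtain B c where "finite B" "0 < c"
      "\<And>x w. (x, w) \<in> T \<Longrightarrow> (\<And>b. b \<in> B \<Longrightarrow> l2_inner x b = 0) \<Longrightarrow>
        c * l2_norm x \<le> l2_norm (w - scale_seq (of_real lam) x)"
      using bounded_below_off_essential_spectrum[OF T K(2)[OF lam]] by metis
    from few_truncation_eigenvalues_nearby[OF ext this]
    have "\<forall>n. card (?\<sigma> n \<inter> ball lam (c / 2)) \<le> card B + 1" by blast
    then show ?thesis using half_gt_zero[OF \<open>0 < c\<close>] by blast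
  qed
  then obtain \<delta> m where \<delta>: "\<And>lam. lam \<in> K \<Longrightarrow> 0 < \<delta> lam"
    and m: "\<And>lam n. lam \<in> K \<Longrightarrow> card (?\<sigma> n \<inter> ball lam (\<delta> lam)) \<le> m lam" by metis
  obtain F where F: "F \<subseteq> K" "finite F" "K \<subseteq> (\<Union>lam\<in>F. ball lam (\<delta> lam))"
  proof (rule compactE_image[OF K(1)])
    show "K \<subseteq> (\<Union>lam\<in>K. ball lam (\<delta> lam))" using \<delta> by force
  qed (rule open_ball, rule that)
  show thesis
  proof (rule that)
    fix n
    have "card (?\<sigma> n \<inter> K) \<le> card (\<Union>lam\<in>F. ?\<sigma> n \<inter> ball lam (\<delta> lam))"
      by (rule card_mono) (use F fin in auto)
    also have "\<dots> \<le> (\<Sum>lam\<in>F. card (?\<sigma> n \<inter> ball lam (\<delta> lam)))"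
      by (rule card_UN_le[OF F(2)])
    also have "\<dots> \<le> (\<Sum>lam\<in>F. m lam)" by (intro sum_mono m) (use F in auto)
    finally show "card (?\<sigma> n \<inter> K) \<le> (\<Sum>lam\<in>F. m lam)" .
  qed
qed

section \<open>Integrals against the counting measures\<close>

lemma integral_dirac_sum:
  fixes f :: "real \<Rightarrow> real"
  assumes S: "finite S" and f: "f \<in> borel_measurable borel"
  shows "(\<integral>x. f x \<partial>(dirac_sum S)) = (\<Sum>y\<in>S. f y)"
proof -
  have "dirac_sum S = distr (count_space S) borel (\<lambda>x. x)"
  proof (rule measure_eqI)
    fix X assume "X \<in> sets (dirac_sum S)"
    then have X: "X \<in> sets borel" by simp
    have "emeasure (distr (count_space S) borel (\<lambda>x. x)) X = of_nat (card (X \<inter> S))"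
      using X S by (simp add: emeasure_distr emeasure_count_space_finite)
    also have "\<dots> = (\<Sum>y\<in>S. indicator X y)"
      using S by (simp add: indicator_def sum.If_cases Int_commute)
    finally show "emeasure (dirac_sum S) X = emeasure (distr (count_space S) borel (\<lambda>x. x)) X"
      using X by (simp add: emeasure_dirac_sum emeasure_return)
  qed simp
  then show ?thesis
    using S f by (simp add: integral_distr lebesgue_integral_count_space_finite)
qed

theorem proposition3p3:
  fixes a b :: "nat \<Rightarrow> real" and \<rho> :: "nat \<Rightarrow> real" and T :: l2_graph
    and l u :: ereal and f :: "real \<Rightarrow> real"
  assumes "\<And>n. a n > 0"
    and "\<And>n. \<rho> n > 0"
    and "filterlim \<rho> at_top sequentially"
    and "self_adjoint_op T" and "jacobi_operator a b \<subseteq> T"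
    and "essential_spectrum T \<inter> complex_of_real ` {x. l < ereal x \<and> ereal x < u} = {}"
    and "continuous_on UNIV f"
    and "compact (closure {x. f x \<noteq> 0})"
    and "closure {x. f x \<noteq> 0} \<subseteq> {x. l < ereal x \<and> ereal x < u}"
  shows "(\<lambda>n. 1 / \<rho> n * (\<integral>x. f x \<partial>(nu a b n))) \<longlonglongrightarrow> 0"
proof -
  let ?K = "closure {x. f x \<noteq> 0}" and ?\<sigma> = "\<lambda>n. spectrum (jacobi_truncation a b (Suc n))"
  have "complex_of_real lam \<notin> essential_spectrum T" if "lam \<in> ?K" for lam
    using that assms(6,9) by blast
  then obtain M where M: "\<And>n. card (?\<sigma> n \<inter> ?K) \<le> M"
    using truncation_eigenvalue_count_bounded[OF assms(4,5,8)] by blast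
  have "bounded (f ` ?K)"
    by (intro compact_imp_bounded compact_continuous_image assms(8))
      (rule continuous_on_subset[OF assms(7)], simp)
  then obtain C where C: "\<And>x. x \<in> ?K \<Longrightarrow> \<bar>f x\<bar> \<le> C" by (auto simp: bounded_iff)
  have f0: "f x = 0" if "x \<notin> ?K" for x using that closure_subset[of "{x. f x \<noteq> 0}"] by blast
  have fin: "finite (?\<sigma> n)" for n
    by (rule card_finite_spectrum[of _ "Suc n"]) (simp add: jacobi_truncation_def)
  have int: "\<bar>\<integral>x. f x \<partial>(nu a b n)\<bar> \<le> real M * \<bar>C\<bar>" for n
  proof -
    have "(\<integral>x. f x \<partial>(nu a b n)) = (\<Sum>y\<in>?\<sigma> n. f y)"
      unfolding nu_def using fin borel_measurable_continuous_onI[OF assms(7)]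
      by (rule integral_dirac_sum)
    also have "\<dots> = (\<Sum>y\<in>?\<sigma> n \<inter> ?K. f y)"
      by (rule sum.mono_neutral_right[OF fin Int_lower1]) (use f0 in blast)
    also have "\<bar>\<dots>\<bar> \<le> real (card (?\<sigma> n \<inter> ?K)) * \<bar>C\<bar>"
      by (rule order_trans[OF sum_abs]) (rule sum_bounded_above, use C in force)
    also have "\<dots> \<le> real M * \<bar>C\<bar>" using M[of n] by (intro mult_right_mono) auto
    finally show ?thesis .
  qed
  show ?thesis
  proof (rule Lim_null_comparison)
    show "\<forall>\<^sub>F n in sequentially. norm (1 / \<rho> n * (\<integral>x. f x \<partial>(nu a b n))) \<le> real M * \<bar>C\<bar> / \<rho> n"
    proof (rule always_eventually, rule allI)
      fix n
      show "norm (1 / \<rho> n * (\<integral>x. f x \<partial>(nu a b n))) \<le> real M * \<bar>C\<bar> / \<rho> n"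
        using int[of n] assms(2)[of n] by (simp add: abs_mult divide_right_mono)
    qed
    show "(\<lambda>n. real M * \<bar>C\<bar> / \<rho> n) \<longlonglongrightarrow> 0"
      by (rule tendsto_divide_0[OF tendsto_const filterlim_at_top_imp_at_infinity[OF assms(3)]])
  qed
qed

end
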